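(* Let $\vec{p}=(p_1,\dots,p_n)$ with $2<\vec{p}<\infty$, let $-\frac{1}{n}\sum_{i=1}^n\frac{1}{2p_i}<\lambda<0$, let $0<\alpha<\min\Big\{n\Big(1-\frac{1}{n}\sum_{i=1}^n\frac{1}{p_i}\Big),\ n\Big(\lambda+\frac{1}{n}\sum_{i=1}^n\frac{1}{p_i}\Big)\Big\}$, and $\beta=\lambda-\frac{\alpha}{n}$. For a locally integrable function $b$ on $\mathbb{R}^n$, the following are equivalent: (a) $b\in\mathfrak{C}^{\vec{p},\lambda}(\mathbb{R}^n)$; (b) both $\mathcal{H}_{\alpha,b}$ and $\mathcal{H}^*_{\alpha,b}$ are bounded from $\mathcal{B}^{\vec{p},\beta}(\mathbb{R}^n)$ to $\mathcal{B}^{\vec{p},2\lambda}(\mathbb{R}^n)$.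
   Context: For an exponent vector $\vec{p}=(p_1,\dots,p_n)$ with $0<p_i<\infty$, the mixed Lebesgue norm of measurable $f$ on $\mathbb{R}^n$ is $$\|f\|_{L^{\vec{p}}}=\Big(\int_{\mathbb{R}}\cdots\Big(\int_{\mathbb{R}}\Big(\int_{\mathbb{R}}|f(x_1,\dots,x_n)|^{p_1}dx_1\Big)^{p_2/p_1}dx_2\Big)^{p_3/p_2}\cdots dx_n\Big)^{1/p_n}.$$ For a ball $B$, $f_B=\frac1{|B|}\int_B f$, and $\chi_B$ is its indicator. For $\lambda\in\mathbb{R}$, $\mathcal{B}^{\vec{p},\lambda}(\mathbb{R}^n)$ (mixed $\lambda$-central Morrey space) consists of measurable $f$ with $\|f\|_{\mathcal{B}^{\vec{p},\lambda}}=\sup_{r>0}\frac{\|f\chi_{B(0,r)}\|_{L^{\vec p}}}{|B(0,r)|^{\lambda}\|\chi_{B(0,r)}\|_{L^{\vec p}}}<\infty$. For $1\le\vec p<\infty$, $-\frac1n\sum_i\frac1{p_i}<\lambda<\frac1n$, $\mathfrak{C}^{\vec{p},\lambda}(\mathbb{R}^n)$ (mixed central Campanato space) consists of measurable $f$ with $\|f\|_{\mathfrak{C}^{\vec{p},\lambda}}=\sup_{r>0}\frac{\|(f-f_{B(0,r)})\chi_{B(0,r)}\|_{L^{\vec p}}}{|B(0,r)|^{\lambda}\|\chi_{B(0,r)}\|_{L^{\vec p}}}<\infty$. For $0<\alpha<n$: $\mathcal{H}_\alpha f(x)=|x|^{\alpha-n}\int_{|t|<|x|}f(t)\,dt$,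 $\mathcal{H}^*_\alpha f(x)=\int_{|t|\ge|x|}f(t)|t|^{\alpha-n}\,dt$ ($x\ne0$), $\mathcal{H}_{\alpha,b}f=b\,\mathcal{H}_\alpha f-\mathcal{H}_\alpha(bf)$, $\mathcal{H}^*_{\alpha,b}f=b\,\mathcal{H}^*_\alpha f-\mathcal{H}^*_\alpha(bf)$. Boundedness from $X$ to $Y$ means $\|Tf\|_Y\le C\|f\|_X$ for all $f\in X$. *)

theory Defs
  imports "HOL-Analysis.Analysis"
begin

text \<open>Points of R^n are vectors (real, 'n) vec; the coordinates x_1,...,x_n are the elements
  of the finite index type 'n listed in increasing order (type class linorder).
  Exponent vectors are functions p :: 'n => real.\<close>

definition epowr :: "ennreal \<Rightarrow> real \<Rightarrow> ennreal" where
  "epowr a r = (if a = \<infinity> then \<infinity> else ennreal (enn2real a powr r))"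

definition vupd :: "(real, 'n::finite) vec \<Rightarrow> 'n \<Rightarrow> real \<Rightarrow> (real, 'n) vec" where
  "vupd x i t = (\<chi> j. if j = i then t else x $ j)"

text \<open>Iterated integration: integrate successively in the coordinates of the list,
  the first element of the list being the innermost integral.\<close>
fun mixed_aux :: "('n::finite \<Rightarrow> real) \<Rightarrow> 'n list \<Rightarrow> ((real, 'n) vec \<Rightarrow> ennreal) \<Rightarrow> ((real, 'n) vec \<Rightarrow> ennreal)" where
  "mixed_aux p [] g = g"
| "mixed_aux p (i # is) g =
     mixed_aux p is (\<lambda>x. epowr (\<integral>\<^sup>+ t. epowr (g (vupd x i t)) (p i) \<partial>lebesgue) (1 / p i))"

definition mixed_norm :: "('n::{finite,linorder} \<Rightarrow> real) \<Rightarrow> ((real, 'n) vec \<Rightarrow> real) \<Rightarrow> ennreal" where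
  "mixed_norm p f = mixed_aux p (sorted_list_of_set UNIV) (\<lambda>x. ennreal \<bar>f x\<bar>) 0"


definition morrey_norm :: "('n::{finite,linorder} \<Rightarrow> real) \<Rightarrow> real \<Rightarrow> ((real, 'n) vec \<Rightarrow> real) \<Rightarrow> ennreal" where
  "morrey_norm p lam f = (SUP r\<in>{0<..}.
      mixed_norm p (\<lambda>x. f x * indicator (ball 0 r) x)
      / (ennreal (measure lebesgue (ball (0::(real, 'n) vec) r) powr lam)
         * mixed_norm p (indicator (ball (0::(real, 'n) vec) r))))"

definition morrey_space :: "('n::{finite,linorder} \<Rightarrow> real) \<Rightarrow> real \<Rightarrow> ((real, 'n) vec \<Rightarrow> real) set" where
  "morrey_space p lam = {f. f \<in> borel_measurable lebesgue \<and> morrey_norm p lam f < \<infinity>}"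

definition ball_avg :: "((real, 'n::finite) vec \<Rightarrow> real) \<Rightarrow> real \<Rightarrow> real" where
  "ball_avg f r = (LINT t:ball 0 r|lebesgue. f t) / measure lebesgue (ball (0::(real, 'n) vec) r)"

definition campanato_norm :: "('n::{finite,linorder} \<Rightarrow> real) \<Rightarrow> real \<Rightarrow> ((real, 'n) vec \<Rightarrow> real) \<Rightarrow> ennreal" where
  "campanato_norm p lam f = (SUP r\<in>{0<..}.
      mixed_norm p (\<lambda>x. (f x - ball_avg f r) * indicator (ball 0 r) x)
      / (ennreal (measure lebesgue (ball (0::(real, 'n) vec) r) powr lam)
         * mixed_norm p (indicator (ball (0::(real, 'n) vec) r))))"

definition campanato_space :: "('n::{finite,linorder} \<Rightarrow> real) \<Rightarrow> real \<Rightarrow> ((real, 'n) vec \<Rightarrow> real) set" where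
  "campanato_space p lam = {f. f \<in> borel_measurable lebesgue \<and> campanato_norm p lam f < \<infinity>}"

text \<open>fractional Hardy operator and its adjoint (the value at x = 0 is set to 0)\<close>
definition hardy :: "real \<Rightarrow> ((real, 'n::finite) vec \<Rightarrow> real) \<Rightarrow> (real, 'n) vec \<Rightarrow> real" where
  "hardy \<alpha> f x = norm x powr (\<alpha> - real CARD('n)) * (LINT t:ball 0 (norm x)|lebesgue. f t)"

definition hardy_adj :: "real \<Rightarrow> ((real, 'n::finite) vec \<Rightarrow> real) \<Rightarrow> (real, 'n) vec \<Rightarrow> real" where
  "hardy_adj \<alpha> f x = (if x = 0 then 0 else
     (LINT t:{t. norm t \<ge> norm x}|lebesgue. f t * norm t powr (\<alpha> - real CARD('n))))"

definition hardy_comm :: "real \<Rightarrow> ((real, 'n::finite) vec \<Rightarrow> real) \<Rightarrow> ((real, 'n) vec \<Rightarrow> real) \<Rightarrow> (real, 'n) vec \<Rightarrow> real" where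
  "hardy_comm \<alpha> b f x = b x * hardy \<alpha> f x - hardy \<alpha> (\<lambda>t. b t * f t) x"

definition hardy_adj_comm :: "real \<Rightarrow> ((real, 'n::finite) vec \<Rightarrow> real) \<Rightarrow> ((real, 'n) vec \<Rightarrow> real) \<Rightarrow> (real, 'n) vec \<Rightarrow> real" where
  "hardy_adj_comm \<alpha> b f x = b x * hardy_adj \<alpha> f x - hardy_adj \<alpha> (\<lambda>t. b t * f t) x"

definition morrey_bounded ::
  "('n::{finite,linorder} \<Rightarrow> real) \<Rightarrow> real \<Rightarrow> real \<Rightarrow> (((real, 'n) vec \<Rightarrow> real) \<Rightarrow> ((real, 'n) vec \<Rightarrow> real)) \<Rightarrow> bool" where
  "morrey_bounded p lam1 lam2 T = (\<exists>C\<ge>0. \<forall>f\<in>morrey_space p lam1.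
      morrey_norm p lam2 (T f) \<le> ennreal C * morrey_norm p lam1 f)"

definition locally_integrable :: "((real, 'n::finite) vec \<Rightarrow> real) \<Rightarrow> bool" where
  "locally_integrable b = (\<forall>K. compact K \<longrightarrow> set_integrable lebesgue K b)"

end

theory Submission
  imports Defs
begin

text \<open>
  Write \<open>S = \<Sum>i. 1 / p i\<close> and let \<open>B(r)\<close> be the ball of radius \<open>r\<close> about the origin. Two-sided comparison
  with cubes shows that the mixed norm of the indicator of \<open>B(r)\<close> is of order \<open>r powr S\<close>, and since all
  exponents exceed 2, Cauchy-Schwarz together with the embedding of the mixed norm into \<open>L\<^sup>2\<close> bounds the
  integral of \<open>\<bar>f g\<bar>\<close> over \<open>B(r)\<close> by \<open>r powr (n - 2 S)\<close> times the product of the mixed norms of \<open>f\<close>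
  and \<open>g\<close> on \<open>B(r)\<close>.

  If \<open>b\<close> is in the Campanato space, both commutators are dominated for \<open>r/2 \<le> \<bar>x\<bar> < r\<close> by
  \<open>\<bar>b x - avg r\<bar> * r powr (n lam) + r powr (2 n lam)\<close>, up to constants and the norm of \<open>f\<close>; for the adjoint
  operator the tail is split into dyadic annuli, and the averages of \<open>b\<close> over dyadic balls stay within
  a geometric sum because \<open>lam < 0\<close>. Summing over the annuli inside \<open>B(R)\<close> with Minkowski's inequality converges
  because \<open>2 n lam + S > 0\<close>.

  Conversely, on \<open>B(r)\<close> the function \<open>\<bar>B(r)\<bar> * (b x - avg r)\<close> equals \<open>\<bar>x\<bar> powr (n - \<alpha>)\<close> times the Hardy
  commutator of the indicator of \<open>B(r)\<close>, plus the adjoint commutator of \<open>\<bar>y\<bar> powr (n - \<alpha>)\<close> restricted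
  to \<open>B(r)\<close>.
\<close>

section \<open>Powers and one-dimensional norms\<close>

lemma epowr_top [simp]: "epowr top r = top"
  by (simp add: epowr_def)

lemma epowr_zero [simp]: "epowr 0 r = 0"
  by (simp add: epowr_def)

lemma epowr_ennreal: "0 \<le> a \<Longrightarrow> epowr (ennreal a) r = ennreal (a powr r)"
  by (simp add: epowr_def)

lemma epowr_mono: "a \<le> b \<Longrightarrow> 0 \<le> r \<Longrightarrow> epowr a r \<le> epowr b r"
  by (cases a; cases b) (auto simp: epowr_ennreal top_unique intro!: ennreal_leI powr_mono2)

text \<open>The values 0 and \<open>top\<close> are fixed by \<open>epowr\<close> for every
  exponent, so the power laws here and in \<open>epowr_mult\<close> hold without sign or finiteness
  conditions.\<close>

lemma epowr_epowr: "epowr (epowr a r) s = epowr a (r * s)"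
  by (cases a) (auto simp: epowr_ennreal powr_powr)

lemma epowr_one [simp]: "epowr a 1 = a"
  by (cases a) (auto simp: epowr_ennreal)

lemma epowr_two: "epowr a 2 = a\<^sup>2"
  by (cases a) (auto simp: epowr_ennreal ennreal_power power2_eq_square ennreal_mult_top ennreal_mult)

lemma epowr_mult: "epowr (a * b) r = epowr a r * epowr b r"
proof (cases a; cases b)
  fix x y assume "a = ennreal x" "b = ennreal y" "0 \<le> x" "0 \<le> y"
  then show ?thesis
    by (simp add: epowr_ennreal powr_mult flip: ennreal_mult)
qed (auto simp: epowr_ennreal ennreal_mult_top ennreal_top_mult ennreal_mult_eq_top_iff epowr_def)

lemma epowr_eq_0_iff [simp]: "epowr a r = 0 \<longleftrightarrow> a = 0"
  by (cases a) (auto simp: epowr_ennreal)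

lemma epowr_le_swap:
  assumes "0 < r" shows "epowr a (1 / r) \<le> b \<longleftrightarrow> a \<le> epowr b r"
  using epowr_mono[of "epowr a (1 / r)" b r] epowr_mono[of a "epowr b r" "1 / r"] assms
  by (auto simp: epowr_epowr)

text \<open>A positive power is an order isomorphism with inverse exponent \<open>1 / r\<close>;
  least upper bounds are therefore preserved without a continuity argument.\<close>

lemma epowr_SUP:
  assumes "0 < r" shows "epowr (SUP k\<in>K. f k) r = (SUP k\<in>K. epowr (f k) r)"
proof (rule antisym)
  have "f k \<le> epowr (SUP k\<in>K. epowr (f k) r) (1 / r)" if "k \<in> K" for k
    using epowr_mono[OF SUP_upper[OF that, of "\<lambda>k. epowr (f k) r"], of "1 / r"] assms
    by (simp add: epowr_epowr)
  then have "(SUP k\<in>K. f k) \<le> epowr (SUP k\<in>K. epowr (f k) r) (1 / r)"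
    by (rule SUP_least)
  from epowr_mono[OF this, of r] assms show "epowr (SUP k\<in>K. f k) r \<le> (SUP k\<in>K. epowr (f k) r)"
    by (simp add: epowr_epowr)
qed (auto intro!: SUP_least epowr_mono SUP_upper less_imp_le[OF assms])

lemma borel_measurable_epowr [measurable]:
  assumes [measurable]: "f \<in> borel_measurable M"
  shows "(\<lambda>x. epowr (f x) r) \<in> borel_measurable M"
proof -
  have "(\<lambda>x. enn2real (f x) powr r) \<in> borel_measurable M"
    by (intro powr_real_measurable) auto
  then show ?thesis
    unfolding epowr_def infinity_ennreal_def by measurable
qed

text \<open>Convexity of the power function is invoked on the open half-line only; when one base
  vanishes, the claim reduces to s^q \<le> s for weights s in [0, 1].\<close>

lemma powr_convex_combination:
  fixes a b s t q :: real
  assumes "1 \<le> q" "0 \<le> a" "0 \<le> b" "0 \<le> s" "0 \<le> t" "s + t = 1"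
  shows "(s * a + t * b) powr q \<le> s * a powr q + t * b powr q"
proof -
  have single: "(s * b) powr q \<le> s * b powr q" if "0 \<le> s" "s \<le> 1" "0 \<le> b" for s b :: real
  proof (cases "s = 0")
    case False
    then have "s powr q \<le> s powr 1"
      using that assms(1) by (intro powr_mono') auto
    with that show ?thesis
      by (simp add: powr_mult mult_right_mono)
  qed simp
  have "s = 1 - t" using assms by simp
  consider "a = 0" | "b = 0" | "0 < a" "0 < b" using assms by linarith
  then show ?thesis
  proof cases
    case 1 then show ?thesis using single[of t b] assms by simp
  next
    case 2 then show ?thesis using single[of s a] assms by simp
  next
    case 3
    have "convex_on {0<..} (\<lambda>x::real. x powr q)"
      using assms(1) powr_convex by blast
    from convex_onD[OF this, of t a b] 3 assms show ?thesis
      by (simp add: \<open>s = 1 - t\<close>)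
  qed
qed

text \<open>The sum is (A + B) times the convex combination of u / A and v / B with weights A / (A +
  B) and B / (A + B). Taking for A and B the norms of the two summands turns this pointwise bound
  into Minkowski's inequality upon integration.\<close>

lemma epowr_sum_convex:
  assumes "1 \<le> q" "0 < A" "0 < B"
  shows "epowr (u + v) q \<le> ennreal ((A + B) powr q) *
     (ennreal (A / (A + B) * A powr - q) * epowr u q + ennreal (B / (A + B) * B powr - q) * epowr v q)"
proof (cases "u = top \<or> v = top")
  case True
  moreover have "0 < (A + B) powr q" "0 < A / (A + B) * A powr - q" "0 < B / (A + B) * B powr - q"
    using assms by simp_all
  ultimately have "ennreal ((A + B) powr q) *
     (ennreal (A / (A + B) * A powr - q) * epowr u q + ennreal (B / (A + B) * B powr - q) * epowr v q) = top"
    by (elim disjE) (auto simp: ennreal_mult_top ennreal_mult_eq_top_iff not_le)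
  then show ?thesis by simp
next
  case False
  then obtain x y where xy: "u = ennreal x" "0 \<le> x" "v = ennreal y" "0 \<le> y"
    by (cases u; cases v) auto
  have AB: "A / (A + B) + B / (A + B) = 1" using assms by (simp add: add_divide_distrib[symmetric])
  have e: "x + y = (A + B) * (A / (A + B) * (x / A) + B / (A + B) * (y / B))"
    using assms by (simp add: add_divide_distrib[symmetric])
  have "(x + y) powr q = (A + B) powr q * (A / (A + B) * (x / A) + B / (A + B) * (y / B)) powr q"
    by (subst e, subst powr_mult) (use assms xy in \<open>auto intro!: add_nonneg_nonneg\<close>)
  also have "\<dots> \<le> (A + B) powr q * (A / (A + B) * (x / A) powr q + B / (A + B) * (y / B) powr q)"
    by (intro mult_left_mono powr_convex_combination) (use assms xy AB in auto)
  also have "\<dots> = (A + B) powr q *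
     (A / (A + B) * A powr - q * x powr q + B / (A + B) * B powr - q * y powr q)"
    using assms xy by (simp add: powr_divide powr_minus_divide)
  finally show ?thesis
    using xy assms by (simp add: epowr_ennreal ennreal_leI flip: ennreal_mult ennreal_plus)
qed

section \<open>One-dimensional norms and Minkowski's inequality\<close>

definition lnorm :: "real \<Rightarrow> 'a measure \<Rightarrow> ('a \<Rightarrow> ennreal) \<Rightarrow> ennreal" where
  "lnorm q M u = epowr (\<integral>\<^sup>+ t. epowr (u t) q \<partial>M) (1 / q)"

lemma lnorm_mono_AE: "AE t in M. u t \<le> v t \<Longrightarrow> 0 < q \<Longrightarrow> lnorm q M u \<le> lnorm q M v"
  unfolding lnorm_def by (intro epowr_mono nn_integral_mono_AE) (auto elim!: eventually_mono intro: epowr_mono)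

lemma lnorm_cmult:
  assumes "u \<in> borel_measurable M" "0 < q"
  shows "lnorm q M (\<lambda>t. c * u t) = c * lnorm q M u"
  using assms by (simp add: lnorm_def epowr_mult nn_integral_cmult epowr_epowr)

lemma lnorm_SUP:
  assumes "\<And>k. u k \<in> borel_measurable M" "incseq u" "0 < q"
  shows "lnorm q M (\<lambda>t. SUP k. u k t) = (SUP k. lnorm q M (u k))"
proof -
  have "(\<integral>\<^sup>+ t. epowr (SUP k. u k t) q \<partial>M) = (\<integral>\<^sup>+ t. (SUP k. epowr (u k t) q) \<partial>M)"
    by (simp add: epowr_SUP assms)
  also have "\<dots> = (SUP k. \<integral>\<^sup>+ t. epowr (u k t) q \<partial>M)"
    using assms by (intro nn_integral_monotone_convergence_SUP)
      (auto simp: incseq_def le_fun_def intro!: epowr_mono)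
  finally show ?thesis
    using assms by (simp add: lnorm_def epowr_SUP)
qed

lemma lnorm_eq_0_iff:
  assumes "u \<in> borel_measurable M" "0 < q"
  shows "lnorm q M u = 0 \<longleftrightarrow> (AE t in M. u t = 0)"
  using assms by (simp add: lnorm_def nn_integral_0_iff_AE)

lemma epowr_lnorm: "0 < q \<Longrightarrow> epowr (lnorm q M u) q = (\<integral>\<^sup>+ t. epowr (u t) q \<partial>M)"
  by (simp add: lnorm_def epowr_epowr)

text \<open>If a norm is 0 that function vanishes almost everywhere, and if one is infinite there is
  nothing to prove; otherwise \<open>epowr_sum_convex\<close> is integrated with the two norms as A
  and B.\<close>

lemma lnorm_triangle:
  assumes [measurable]: "u \<in> borel_measurable M" "v \<in> borel_measurable M" and q: "1 \<le> q"
  shows "lnorm q M (\<lambda>t. u t + v t) \<le> lnorm q M u + lnorm q M v"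
proof -
  consider "lnorm q M u = 0" | "lnorm q M v = 0" | "lnorm q M u = top \<or> lnorm q M v = top"
    | A B where "lnorm q M u = ennreal A" "lnorm q M v = ennreal B" "0 < A" "0 < B"
    by (cases "lnorm q M u"; cases "lnorm q M v") (auto simp: less_le ennreal_0)
  then show ?thesis
  proof cases
    case 1
    then have "AE t in M. u t = 0" using q by (subst (asm) lnorm_eq_0_iff) auto
    then have "AE t in M. u t + v t \<le> v t" by eventually_elim simp
    from lnorm_mono_AE[OF this] q 1 show ?thesis by simp
  next
    case 2
    then have "AE t in M. v t = 0" using q by (subst (asm) lnorm_eq_0_iff) auto
    then have "AE t in M. u t + v t \<le> u t" by eventually_elim simp
    from lnorm_mono_AE[OF this] q 2 show ?thesis by simp
  next
    case 3 then show ?thesis by auto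
  next
    case 4
    have u: "(\<integral>\<^sup>+ t. epowr (u t) q \<partial>M) = ennreal (A powr q)"
      and v: "(\<integral>\<^sup>+ t. epowr (v t) q \<partial>M) = ennreal (B powr q)"
      using epowr_lnorm[of q M u] epowr_lnorm[of q M v] q 4 by (auto simp: epowr_ennreal)
    have "(\<integral>\<^sup>+ t. epowr (u t + v t) q \<partial>M) \<le> (\<integral>\<^sup>+ t. ennreal ((A + B) powr q) *
     (ennreal (A / (A + B) * A powr - q) * epowr (u t) q + ennreal (B / (A + B) * B powr - q) * epowr (v t) q) \<partial>M)"
      by (intro nn_integral_mono epowr_sum_convex q 4)
    also have "\<dots> = ennreal ((A + B) powr q) *
      (ennreal (A / (A + B) * A powr - q) * ennreal (A powr q)
        + ennreal (B / (A + B) * B powr - q) * ennreal (B powr q))"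
      by (simp add: nn_integral_cmult nn_integral_add u v)
    also have "\<dots> = ennreal ((A + B) powr q * (A / (A + B) * (A powr - q * A powr q)
        + B / (A + B) * (B powr - q * B powr q)))"
      using 4 by (simp add: mult.assoc flip: ennreal_mult ennreal_plus)
    \<comment> \<open>After normalisation by the norms each integral equals 1, so only the two
      convex weights remain, and they add up to 1.\<close>
    also have "A powr - q * A powr q = 1" using 4 by (simp flip: powr_add)
    also have "B powr - q * B powr q = 1" using 4 by (simp flip: powr_add)
    also have "A / (A + B) * 1 + B / (A + B) * 1 = A / (A + B) + B / (A + B)" by simp
    also have "A / (A + B) + B / (A + B) = 1" using 4 by (simp add: add_divide_distrib[symmetric])
    finally have "(\<integral>\<^sup>+ t. epowr (u t + v t) q \<partial>M) \<le> epowr (ennreal (A + B)) q"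
      using 4 by (simp add: epowr_ennreal del: ennreal_plus)
    then have "lnorm q M (\<lambda>t. u t + v t) \<le> ennreal (A + B)"
      unfolding lnorm_def using q by (subst epowr_le_swap) simp_all
    then show ?thesis using 4 by simp
  qed
qed

section \<open>Iterated norms\<close>

text \<open>Completion does not change nonnegative integrals, so the inner integrals can be taken
  over \<open>lborel\<close>, where Borel measurability of sections suffices.\<close>

lemma mixed_aux_Cons:
  "mixed_aux p (i # is) g = mixed_aux p is (\<lambda>x. lnorm (p i) lborel (\<lambda>t. g (vupd x i t)))"
  by (simp add: lnorm_def nn_integral_completion)

lemma borel_measurable_vec_lambda:
  fixes f :: "'a \<Rightarrow> 'n::finite \<Rightarrow> real"
  assumes "\<And>j. (\<lambda>y. f y j) \<in> borel_measurable M"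
  shows "(\<lambda>y. \<chi> j. f y j) \<in> borel_measurable M"
  using assms by (subst borel_measurable_euclidean_space) (auto simp: Basis_vec_def inner_axis)

lemma continuous_on_vupd: "continuous_on UNIV (\<lambda>z :: (real, 'n::finite) vec \<times> real. vupd (fst z) i (snd z))"
  unfolding vupd_def
proof (intro continuous_on_vec_lambda)
  fix j show "continuous_on UNIV (\<lambda>z :: (real, 'n) vec \<times> real. if j = i then snd z else fst z $ j)"
    by (cases "j = i") (auto intro!: continuous_intros)
qed

lemma borel_measurable_vupd [measurable (raw)]:
  assumes "f \<in> borel_measurable M" "g \<in> borel_measurable M"
  shows "(\<lambda>x. vupd (f x) i (g x)) \<in> borel_measurable M"
  by (rule borel_measurable_continuous_Pair[OF assms continuous_on_vupd])

lemma borel_measurable_lnorm_vupd [measurable (raw)]: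
  fixes g :: "(real, 'n::finite) vec \<Rightarrow> ennreal"
  assumes [measurable]: "g \<in> borel_measurable borel"
  shows "(\<lambda>x. lnorm q lborel (\<lambda>t. g (vupd x i t))) \<in> borel_measurable borel"
  unfolding lnorm_def by measurable

lemma mixed_aux_cmult:
  fixes p :: "'n::finite \<Rightarrow> real"
  assumes "\<And>i. 0 < p i" "g \<in> borel_measurable borel"
  shows "mixed_aux p is (\<lambda>x. c * g x) x = c * mixed_aux p is g x"
  using assms(2)
proof (induction "is" arbitrary: g)
  case (Cons i "is")
  note [measurable] = Cons.prems
  have "(\<lambda>x. lnorm (p i) lborel (\<lambda>t. c * g (vupd x i t))) =
      (\<lambda>x. c * lnorm (p i) lborel (\<lambda>t. g (vupd x i t)))"
    by (intro ext lnorm_cmult assms(1)) measurable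
  with Cons show ?case
    by (simp del: mixed_aux.simps(2) add: mixed_aux_Cons borel_measurable_lnorm_vupd)
qed simp

lemma mixed_aux_mono:
  assumes "\<And>i. 0 < p i" "\<And>x. g x \<le> h x"
  shows "mixed_aux p is g x \<le> mixed_aux p is h x"
  using assms(2)
proof (induction "is" arbitrary: g h)
  case (Cons i "is")
  show ?case
    unfolding mixed_aux_Cons by (intro Cons.IH lnorm_mono_AE) (auto simp: assms Cons.prems)
qed simp

text \<open>Minkowski's inequality is applied to the innermost integral; monotonicity of the outer
  norms and the induction hypothesis do the rest.\<close>

lemma mixed_aux_triangle:
  assumes "\<And>i. 1 \<le> p i" "g \<in> borel_measurable borel" "h \<in> borel_measurable borel"
  shows "mixed_aux p is (\<lambda>x. g x + h x) x \<le> mixed_aux p is g x + mixed_aux p is h x"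
  using assms(2,3)
proof (induction "is" arbitrary: g h)
  case (Cons i "is")
  note [measurable] = Cons.prems
  have pos: "0 < p j" for j using assms(1)[of j] by simp
  let ?s = "\<lambda>g x. lnorm (p i) lborel (\<lambda>t. g (vupd x i t))"
  have "mixed_aux p is (?s (\<lambda>x. g x + h x)) x \<le> mixed_aux p is (\<lambda>x. ?s g x + ?s h x) x"
    by (intro mixed_aux_mono pos lnorm_triangle assms) measurable
  also have "\<dots> \<le> mixed_aux p is (?s g) x + mixed_aux p is (?s h) x"
    by (intro Cons.IH) measurable
  finally show ?case
    unfolding mixed_aux_Cons .
qed simp

lemma mixed_aux_SUP:
  fixes g :: "nat \<Rightarrow> (real, 'n::finite) vec \<Rightarrow> ennreal"
  assumes "\<And>i. 0 < p i" "\<And>k. g k \<in> borel_measurable borel" "incseq g"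
  shows "mixed_aux p is (\<lambda>x. SUP k. g k x) x = (SUP k. mixed_aux p is (g k) x)"
  using assms(2,3)
proof (induction "is" arbitrary: g)
  case (Cons i "is")
  note [measurable] = Cons.prems(1)
  let ?s = "\<lambda>g x. lnorm (p i) lborel (\<lambda>t. g (vupd x i t))"
  have "?s (\<lambda>x. SUP k. g k x) = (\<lambda>x. SUP k. ?s (g k) x)"
    using incseqD[OF Cons.prems(2)] assms(1)
    by (intro ext lnorm_SUP) (auto intro!: incseq_SucI simp: le_fun_def)
  moreover have "incseq (\<lambda>k. ?s (g k))"
    using incseqD[OF Cons.prems(2)] assms(1)
    by (auto intro!: incseq_SucI lnorm_mono_AE simp: le_fun_def)
  ultimately show ?case
    unfolding mixed_aux_Cons by (simp add: Cons.IH borel_measurable_lnorm_vupd Cons.prems)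
qed simp

lemma mixed_aux_sum:
  assumes "\<And>i. 1 \<le> p i" "\<And>k. g k \<in> borel_measurable borel"
  shows "mixed_aux p is (\<lambda>x. \<Sum>k<(m::nat). g k x) x \<le> (\<Sum>k<m. mixed_aux p is (g k) x)"
proof (induction m)
  case 0
  \<comment> \<open>The zero function is written as 0 times a function, so that homogeneity yields
    norm 0.\<close>
  have "mixed_aux p is (\<lambda>x. 0 * 0) x = 0"
    using assms by (subst mixed_aux_cmult) (auto intro: less_le_trans[of 0 1])
  then show ?case by simp
next
  case (Suc m)
  have "mixed_aux p is (\<lambda>x. (\<Sum>k<m. g k x) + g m x) x \<le>
      mixed_aux p is (\<lambda>x. \<Sum>k<m. g k x) x + mixed_aux p is (g m) x"
    using assms by (intro mixed_aux_triangle) measurable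
  with Suc show ?case
    by (simp add: add_right_mono order_trans)
qed

text \<open>Partial sums increase to the series, so monotone convergence extends the finite triangle
  inequality; this form is what sums the annuli in \<open>annular_bound\<close>.\<close>

lemma mixed_aux_suminf:
  fixes g :: "nat \<Rightarrow> (real, 'n::finite) vec \<Rightarrow> ennreal"
  assumes "\<And>i. 1 \<le> p i" "\<And>k. g k \<in> borel_measurable borel"
  shows "mixed_aux p is (\<lambda>x. \<Sum>k. g k x) x \<le> (\<Sum>k. mixed_aux p is (g k) x)"
proof -
  have pos: "0 < p j" for j using assms(1)[of j] by simp
  have "mixed_aux p is (\<lambda>x. \<Sum>k. g k x) x = (SUP m. mixed_aux p is (\<lambda>x. \<Sum>k<m. g k x) x)"
    unfolding suminf_eq_SUP using assms pos
    by (intro mixed_aux_SUP) (auto simp: incseq_def le_fun_def intro!: sum_mono2)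
  also have "\<dots> \<le> (SUP m. \<Sum>k<m. mixed_aux p is (g k) x)"
    by (intro SUP_mono) (use mixed_aux_sum[of p g, OF assms] in auto)
  finally show ?thesis
    by (simp add: suminf_eq_SUP)
qed

section \<open>Exponents 1 and 2, and insensitivity to null sets\<close>

lemma lnorm_1: "lnorm 1 M u = (\<integral>\<^sup>+ t. u t \<partial>M)"
  by (simp add: lnorm_def)

text \<open>The square root ending one integration cancels against the square opening the next, so a
  single root survives outside the iterated integral.\<close>

lemma mixed_aux_2:
  "mixed_aux (\<lambda>_. 2) is g x = epowr (mixed_aux (\<lambda>_. 1) is (\<lambda>y. epowr (g y) 2) x) (1 / 2)"
proof (induction "is" arbitrary: g)
  case (Cons i "is")
  show ?case
    unfolding mixed_aux_Cons Cons.IH by (simp add: lnorm_1 epowr_lnorm)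
qed (simp add: epowr_epowr)

interpretation lborel_product: product_sigma_finite "\<lambda>_ :: 'i. lborel :: real measure"
  by standard

text \<open>Tonelli's theorem, one coordinate at a time. Coordinates outside the list keep their
  values from x, which makes the induction over partial lists possible.\<close>

lemma mixed_aux_1_eq_PiM:
  fixes g :: "(real, 'n::finite) vec \<Rightarrow> ennreal"
  assumes "g \<in> borel_measurable borel" "distinct is"
  shows "mixed_aux (\<lambda>_. 1) is g x =
    (\<integral>\<^sup>+ y. g (\<chi> j. if j \<in> set is then y j else x $ j) \<partial>Pi\<^sub>M (set is) (\<lambda>_. lborel))"
  using assms
proof (induction "is" arbitrary: g)
  case Nil
  then show ?case by (simp add: space_PiM)
next
  case (Cons i "is")
  note [measurable] = Cons.prems(1)
  have m: "(\<lambda>y. \<chi> j. if j \<in> J then y j else x $ j) \<in> borel_measurable (Pi\<^sub>M J (\<lambda>_. lborel :: real measure))" for J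
  proof (intro borel_measurable_vec_lambda)
    fix j show "(\<lambda>y. if j \<in> J then y j else x $ j) \<in> borel_measurable (Pi\<^sub>M J (\<lambda>_. lborel :: real measure))"
      by (cases "j \<in> J") simp_all
  qed
  have m': "(\<lambda>y. g (\<chi> j. if j \<in> J then y j else x $ j)) \<in> borel_measurable (Pi\<^sub>M J (\<lambda>_. lborel :: real measure))" for J
    by (intro measurable_compose[OF m]) measurable
  have v: "vupd (\<chi> j. if j \<in> set is then y j else x $ j) i t =
      (\<chi> j. if j \<in> set (i # is) then (y(i := t)) j else x $ j)" for y t
    by (auto simp: vupd_def vec_eq_iff)
  have "mixed_aux (\<lambda>_. 1) (i # is) g x = (\<integral>\<^sup>+ y. \<integral>\<^sup>+ t. g (vupd (\<chi> j. if j \<in> set is then y j else x $ j) i t)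
      \<partial>lborel \<partial>Pi\<^sub>M (set is) (\<lambda>_. lborel))"
    unfolding mixed_aux_Cons lnorm_1 using Cons.prems by (intro Cons.IH) auto
  also have "\<dots> = (\<integral>\<^sup>+ y. g (\<chi> j. if j \<in> set (i # is) then y j else x $ j) \<partial>Pi\<^sub>M (set (i # is)) (\<lambda>_. lborel))"
    unfolding v using Cons.prems m'[of "set (i # is)"]
    by (subst list.set(2), subst lborel_product.product_nn_integral_insert) auto
  finally show ?case .
qed

text \<open>Lebesgue measure is the Borel measure that gives each box the product of its side
  lengths, and the product measure transported to vectors does so.\<close>

lemma lborel_vec_eq_distr_PiM:
  "(lborel :: (real, 'n::finite) vec measure) = distr (Pi\<^sub>M UNIV (\<lambda>_. lborel)) borel (\<lambda>y. \<chi> j. y j)"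
proof (rule lborel_eqI)
  fix l u :: "(real, 'n) vec"
  assume le: "\<And>b. b \<in> Basis \<Longrightarrow> l \<bullet> b \<le> u \<bullet> b"
  have le': "l $ i \<le> u $ i" for i
    using le[of "axis i 1"] by (simp add: inner_axis axis_in_Basis_iff)
  have m [measurable]: "(\<lambda>y. \<chi> j::'n. y j) \<in> borel_measurable (Pi\<^sub>M UNIV (\<lambda>_. lborel :: real measure))"
    by (intro borel_measurable_vec_lambda) measurable
  have "emeasure (distr (Pi\<^sub>M UNIV (\<lambda>_. lborel)) borel (\<lambda>y. \<chi> j. y j)) (box l u) =
     emeasure (Pi\<^sub>M UNIV (\<lambda>_. lborel)) (\<Pi>\<^sub>E i\<in>UNIV. {l $ i <..< u $ i})"
    by (subst emeasure_distr) (auto simp: mem_box_cart space_PiM PiE_iff intro!: arg_cong2[where f=emeasure])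
  also have "\<dots> = (\<Prod>i\<in>UNIV. ennreal (u $ i - l $ i))"
    by (subst lborel_product.emeasure_PiM) (auto simp: le')
  also have "\<dots> = ennreal (\<Prod>i\<in>UNIV. u $ i - l $ i)"
    by (rule prod_ennreal) (simp add: le')
  \<comment> \<open>The Euclidean basis consists of the vectors \<open>axis i 1\<close>, hence the
    reindexing by coordinates.\<close>
  also have "(\<Prod>i\<in>UNIV. u $ i - l $ i) = (\<Prod>b\<in>Basis. (u - l) \<bullet> b)"
    by (rule prod.reindex_bij_witness[where j="\<lambda>i. axis i 1" and i="\<lambda>b. SOME i. b = axis i 1"]) 
      (auto simp: inner_axis axis_in_Basis_iff Basis_vec_def axis_eq_axis)
  finally show "emeasure (distr (Pi\<^sub>M UNIV (\<lambda>_. lborel)) borel (\<lambda>y. \<chi> j. y j)) (box l u) =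
     ennreal (\<Prod>b\<in>Basis. (u - l) \<bullet> b)" .
qed simp

lemma mixed_aux_1_eq_nn_integral:
  fixes g :: "(real, 'n::finite) vec \<Rightarrow> ennreal"
  assumes [measurable]: "g \<in> borel_measurable borel" and "distinct is" "set is = UNIV"
  shows "mixed_aux (\<lambda>_. 1) is g x = (\<integral>\<^sup>+ y. g y \<partial>lborel)"
proof -
  have m [measurable]: "(\<lambda>y. \<chi> j::'n. y j) \<in> borel_measurable (Pi\<^sub>M UNIV (\<lambda>_. lborel :: real measure))"
    by (intro borel_measurable_vec_lambda) measurable
  show ?thesis
    using assms by (subst lborel_vec_eq_distr_PiM) (simp add: mixed_aux_1_eq_PiM nn_integral_distr)
qed

text \<open>The witness \<open>\<phi>\<close> of the exceptional set is iterated together with the functions, which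
  makes the inequality propagate through each one-dimensional integration, even when the
  sections of \<open>g\<close> and \<open>h\<close> are not measurable.\<close>

lemma mixed_aux_mono_off_null:
  fixes p :: "'n::finite \<Rightarrow> real"
  assumes "\<And>i. 0 < p i" "\<phi> \<in> borel_measurable borel" "mixed_aux (\<lambda>_. 1) is \<phi> x = 0"
    and "\<And>y. \<phi> y = 0 \<Longrightarrow> g y \<le> h y"
  shows "mixed_aux p is g x \<le> mixed_aux p is h x"
  using assms(2-)
proof (induction "is" arbitrary: g h \<phi>)
  case (Cons i "is")
  note [measurable] = Cons.prems(1)
  show ?case
    unfolding mixed_aux_Cons
  proof (rule Cons.IH[of "\<lambda>x. lnorm 1 lborel (\<lambda>t. \<phi> (vupd x i t))"])
    fix y assume "lnorm 1 lborel (\<lambda>t. \<phi> (vupd y i t)) = 0"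
    then have "AE t in lborel. \<phi> (vupd y i t) = 0"
      by (subst (asm) lnorm_eq_0_iff) auto
    then have "AE t in lborel. g (vupd y i t) \<le> h (vupd y i t)"
      by eventually_elim (rule Cons.prems)
    then show "lnorm (p i) lborel (\<lambda>t. g (vupd y i t)) \<le> lnorm (p i) lborel (\<lambda>t. h (vupd y i t))"
      by (intro lnorm_mono_AE assms)
  qed (use Cons.prems in \<open>simp_all del: mixed_aux.simps(2) add: mixed_aux_Cons borel_measurable_lnorm_vupd\<close>)
qed simp

text \<open>The exceptional set lies in a Borel null set N, whose indicator has iterated integral 0
  by Tonelli and so can serve as the witness in \<open>mixed_aux_mono_off_null\<close>.\<close>

lemma mixed_aux_mono_AE:
  fixes p :: "'n::finite \<Rightarrow> real"
  assumes "\<And>i. 0 < p i" "distinct is" "set is = UNIV" "AE y in lborel. g y \<le> h y"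
  shows "mixed_aux p is g x \<le> mixed_aux p is h x"
proof -
  from AE_E[OF assms(4)] obtain N where N: "{y \<in> space lborel. \<not> g y \<le> h y} \<subseteq> N"
    "emeasure lborel N = 0" "N \<in> sets lborel" .
  have [measurable]: "N \<in> sets borel" using N by simp
  show ?thesis
  proof (rule mixed_aux_mono_off_null[OF assms(1), of "indicator N"])
    show "mixed_aux (\<lambda>_. 1) is (indicator N) x = 0"
      using N assms by (simp add: mixed_aux_1_eq_nn_integral)
  qed (use N in \<open>auto simp: indicator_def split: if_splits\<close>)
qed

section \<open>The mixed norm on balls\<close>

lemma norm_measurable_lebesgue [measurable]:
  "(\<lambda>x :: 'a::euclidean_space. norm x) \<in> borel_measurable lebesgue"
  by (rule measurable_completion) measurable

lemma ball_in_sets [measurable]: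
  "ball c r \<in> sets borel" "ball (c :: 'a::euclidean_space) r \<in> sets lebesgue"
  by auto

text \<open>In place of Hoelder's inequality, the pointwise bound u^2 \<le> s^2 + s^(2 - q) u^q is
  integrated over the support: the first term covers u \<le> s, the second u > s. The price is the
  factor sqrt 2.\<close>

lemma lnorm_2_le_lnorm:
  assumes [measurable]: "u \<in> borel_measurable M" "\<Omega> \<in> sets M"
    and M: "emeasure M \<Omega> = ennreal m" "0 < m" and q: "2 \<le> q"
    and supp: "\<And>t. t \<notin> \<Omega> \<Longrightarrow> u t = 0"
  shows "lnorm 2 M u \<le> ennreal (sqrt 2 * m powr (1 / 2 - 1 / q)) * lnorm q M u"
proof -
  consider "lnorm q M u = 0" | "lnorm q M u = top" | A where "lnorm q M u = ennreal A" "0 < A"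
    by (cases "lnorm q M u") (auto simp: less_le ennreal_0)
  then show ?thesis
  proof cases
    case 1
    then have "AE t in M. u t = 0" using q by (subst (asm) lnorm_eq_0_iff) auto
    then have "lnorm 2 M u = 0" by (subst lnorm_eq_0_iff) auto
    then show ?thesis by simp
  next
    case 2
    then show ?thesis using M by (simp add: ennreal_mult_top)
  next
    case 3
    \<comment> \<open>This is the constant value on \<open>\<Omega>\<close> whose q-norm is A; with
      it both terms of the pointwise bound integrate to s^2 m.\<close>
    define s where "s = A / m powr (1 / q)"
    have s: "0 < s" using 3 M by (simp add: s_def)
    have A: "(\<integral>\<^sup>+ t. epowr (u t) q \<partial>M) = ennreal (A powr q)"
      using epowr_lnorm[of q M u] q 3 by (auto simp: epowr_ennreal)
    have "epowr (u t) 2 \<le> ennreal (s\<^sup>2) * indicator \<Omega> t + ennreal (s powr (2 - q)) * epowr (u t) q" for t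
    proof (cases "t \<in> \<Omega>")
      case True
      show ?thesis
      proof (cases "u t")
        case top
        then show ?thesis using s by (simp add: ennreal_mult_top)
      next
        case (real x)
        have "x powr 2 \<le> s\<^sup>2 + s powr (2 - q) * x powr q"
        proof (cases "x \<le> s")
          case True
          then have "x powr 2 \<le> s powr 2" using real by (intro powr_mono2) auto
          then show ?thesis using s by (simp add: add_increasing2)
        next
          case False
          then have "x powr (2 - q) \<le> s powr (2 - q)"
            using s q by (intro powr_mono2') auto
          then have "x powr (2 - q) * x powr q \<le> s powr (2 - q) * x powr q"
            by (intro mult_right_mono) auto
          then show ?thesis using False s by (simp add: add_increasing flip: powr_add)
        qed
        then show ?thesis using True real s
          by (simp add: epowr_ennreal ennreal_leI flip: ennreal_mult ennreal_plus)
      qed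
    qed (simp add: supp)
    then have "(\<integral>\<^sup>+ t. epowr (u t) 2 \<partial>M) \<le>
       (\<integral>\<^sup>+ t. ennreal (s\<^sup>2) * indicator \<Omega> t + ennreal (s powr (2 - q)) * epowr (u t) q \<partial>M)"
      by (intro nn_integral_mono)
    also have "\<dots> = ennreal (s\<^sup>2) * ennreal m + ennreal (s powr (2 - q)) * ennreal (A powr q)"
      by (simp add: nn_integral_add nn_integral_cmult M A)
    also have "s powr (2 - q) * A powr q = s\<^sup>2 * m"
    proof -
      have "A powr q = s powr q * m"
        using 3 M q by (simp add: s_def powr_divide powr_powr)
      then show ?thesis using s by (simp add: powr_add[symmetric] mult.assoc[symmetric])
    qed
    then have "ennreal (s\<^sup>2) * ennreal m + ennreal (s powr (2 - q)) * ennreal (A powr q) = ennreal (2 * (s\<^sup>2 * m))"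
      using M by (simp flip: ennreal_mult ennreal_plus)
    finally have "lnorm 2 M u \<le> epowr (ennreal (2 * (s\<^sup>2 * m))) (1 / 2)"
      unfolding lnorm_def by (intro epowr_mono) auto
    also have "\<dots> = ennreal (sqrt 2 * (s * sqrt m))"
      using M s by (simp add: epowr_ennreal powr_half_sqrt real_sqrt_mult)
    also have "s * sqrt m = m powr (1 / 2 - 1 / q) * A"
      using M by (simp add: s_def powr_diff powr_half_sqrt)
    finally show ?thesis using M 3 by (simp add: mult.assoc flip: ennreal_mult)
  qed
qed

text \<open>The embedding is applied in each coordinate on the interval from -a to a. Integrating
  out one coordinate leaves the vanishing condition in the remaining ones intact, so the constants
  simply multiply.\<close>

lemma mixed_aux_2_le:
  fixes p :: "'n::finite \<Rightarrow> real"
  assumes "\<And>i. 2 \<le> p i" "0 < a" "g \<in> borel_measurable borel"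
    and "\<And>x j. j \<in> set is \<Longrightarrow> a \<le> \<bar>x $ j\<bar> \<Longrightarrow> g x = 0" "distinct is"
  shows "mixed_aux (\<lambda>_. 2) is g x \<le>
    ennreal (\<Prod>i\<leftarrow>is. sqrt 2 * (2 * a) powr (1 / 2 - 1 / p i)) * mixed_aux p is g x"
  using assms(3-)
proof (induction "is" arbitrary: g)
  case (Cons i "is")
  note [measurable] = Cons.prems(1)
  let ?s = "\<lambda>q x. lnorm q lborel (\<lambda>t. g (vupd x i t))"
  let ?c = "sqrt 2 * (2 * a) powr (1 / 2 - 1 / p i)"
  let ?C = "\<Prod>i\<leftarrow>is. sqrt 2 * (2 * a) powr (1 / 2 - 1 / p i)"
  have pos: "0 < p i" for i using assms(1)[of i] by simp
  have C: "0 \<le> ?C" by (induction "is") auto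
  have supp: "g (vupd y i t) = 0" if "t \<notin> {-a<..<a}" for y t
    using that by (intro Cons.prems(2)[of i]) (auto simp: vupd_def)
  have "mixed_aux (\<lambda>_. 2) is (?s 2) x \<le> mixed_aux (\<lambda>_. 2) is (\<lambda>x. ennreal ?c * ?s (p i) x) x"
    using assms(1,2) supp
    by (intro mixed_aux_mono lnorm_2_le_lnorm[where \<Omega>="{-a<..<a}"]) auto
  also have "\<dots> = ennreal ?c * mixed_aux (\<lambda>_. 2) is (?s (p i)) x"
    by (intro mixed_aux_cmult) auto
  also have "\<dots> \<le> ennreal ?c * (ennreal ?C * mixed_aux p is (?s (p i)) x)"
  proof (intro mult_left_mono Cons.IH)
    fix y j assume j: "j \<in> set is" "a \<le> \<bar>y $ j\<bar>"
    then have "j \<noteq> i" using Cons.prems by auto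
    then have "g (vupd y i t) = 0" for t
      using j by (intro Cons.prems(2)[of j]) (auto simp: vupd_def)
    then show "?s (p i) y = 0" by (simp add: lnorm_def)
  qed (use Cons.prems in auto)
  finally show ?case
    unfolding mixed_aux_Cons using C by (simp add: ennreal_mult mult.assoc)
qed simp

text \<open>The indicator of a cube is a product over coordinates: each integration contributes one
  factor and drops its coordinate from the constraint. The set J is general so that the induction
  can remove coordinates one by one.\<close>

lemma mixed_aux_cube:
  fixes p :: "'n::finite \<Rightarrow> real"
  assumes "\<And>i. 0 < p i" "0 < a" "set is \<subseteq> J" "distinct is"
  shows "mixed_aux p is (indicator {x. \<forall>j\<in>J. \<bar>x $ j\<bar> < a}) x =
    ennreal (\<Prod>i\<leftarrow>is. (2 * a) powr (1 / p i)) * indicator {x. \<forall>j\<in>J - set is. \<bar>x $ j\<bar> < a} x"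
  using assms(3-)
proof (induction "is" arbitrary: J)
  case (Cons i "is")
  let ?Q = "\<lambda>J. {x :: (real, 'n) vec. \<forall>j\<in>J. \<bar>x $ j\<bar> < a}"
  have open_Q: "open (?Q J)" for J
  proof -
    have "?Q J = (\<Inter>j\<in>J. {x. \<bar>x $ j\<bar> < a})" by auto
    also have "open \<dots>" by (intro open_INT ballI open_Collect_less continuous_intros) auto
    finally show ?thesis .
  qed
  have [measurable]: "?Q J \<in> sets borel" for J
    by (intro borel_open open_Q)
  have C: "0 \<le> (\<Prod>i\<leftarrow>is. (2 * a) powr (1 / p i))" by (induction "is") auto
  have "lnorm (p i) lborel (\<lambda>t. indicator (?Q J) (vupd x i t)) =
      ennreal ((2 * a) powr (1 / p i)) * indicator (?Q (J - {i})) x" for x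
  proof -
    have "(\<lambda>t. indicator (?Q J) (vupd x i t)) = (\<lambda>t. indicator (?Q (J - {i})) x * indicator {-a<..<a} t :: ennreal)"
      using Cons.prems by (intro ext) (auto simp: indicator_def vupd_def split: if_splits)
    moreover have "epowr (indicator A t) (p i) = indicator A t" for A and t :: real
      by (simp add: indicator_def epowr_def)
    then have "lnorm (p i) lborel (indicator {-a<..<a}) = ennreal ((2 * a) powr (1 / p i))"
      using assms by (simp add: lnorm_def epowr_ennreal)
    ultimately show ?thesis
      using assms by (simp add: lnorm_cmult) (simp add: mult.commute)
  qed
  then have "mixed_aux p (i # is) (indicator (?Q J)) x =
      ennreal ((2 * a) powr (1 / p i)) * mixed_aux p is (indicator (?Q (J - {i}))) x"
    unfolding mixed_aux_Cons by (simp add: mixed_aux_cmult assms)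
  also have "mixed_aux p is (indicator (?Q (J - {i}))) x =
      ennreal (\<Prod>i\<leftarrow>is. (2 * a) powr (1 / p i)) * indicator (?Q (J - {i} - set is)) x"
    using Cons.prems by (intro Cons.IH) auto
  finally show ?case
    using C by (simp add: ennreal_mult mult.assoc Diff_insert2[symmetric])
qed simp

text \<open>The lemmas on iterated norms ask for Borel functions, since sections of a Lebesgue
  measurable function may fail to be measurable. A Borel representative is substituted, and
  \<open>mixed_aux_mono_AE\<close> shows that the norm does not notice.\<close>

lemma borel_version:
  fixes g :: "'a::euclidean_space \<Rightarrow> ennreal"
  assumes "g \<in> borel_measurable lebesgue"
  obtains g' where "g' \<in> borel_measurable borel" "AE x in lborel. g x = g' x"
  using completion_ex_borel_measurable[OF assms] by auto

section \<open>The mixed norm with exponents above 2: balls and the product inequality\<close>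

locale mixed_exponents =
  fixes p :: "'n::{finite,linorder} \<Rightarrow> real" and n :: real
  assumes p_gt_2: "2 < p i" and n_eq: "n = real CARD('n)"
begin

definition mnorm :: "((real, 'n) vec \<Rightarrow> ennreal) \<Rightarrow> ennreal" where
  "mnorm g = mixed_aux p (sorted_list_of_set UNIV) g 0"

definition S :: real where
  "S = (\<Sum>i\<in>UNIV. 1 / p i)"

lemma p_pos: "0 < p i" and p_ge_1: "1 \<le> p i" and p_ge_2: "2 \<le> p i"
  using p_gt_2[of i] by auto

lemma mixed_norm_eq: "mixed_norm p f = mnorm (\<lambda>x. ennreal \<bar>f x\<bar>)"
  by (simp add: mixed_norm_def mnorm_def)

lemma mnorm_mono_AE: "AE x in lborel. g x \<le> h x \<Longrightarrow> mnorm g \<le> mnorm h"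
  unfolding mnorm_def by (intro mixed_aux_mono_AE p_pos) auto

lemma mnorm_mono: "(\<And>x. g x \<le> h x) \<Longrightarrow> mnorm g \<le> mnorm h"
  by (intro mnorm_mono_AE) auto

lemma mnorm_cong_AE: "AE x in lborel. g x = h x \<Longrightarrow> mnorm g = mnorm h"
  by (intro antisym mnorm_mono_AE) (auto elim: eventually_mono)

lemma mnorm_cmult:
  assumes "g \<in> borel_measurable lebesgue"
  shows "mnorm (\<lambda>x. c * g x) = c * mnorm g"
proof -
  from assms obtain g' where g': "g' \<in> borel_measurable borel" "AE x in lborel. g x = g' x"
    by (rule borel_version)
  have "mnorm (\<lambda>x. c * g x) = mnorm (\<lambda>x. c * g' x)"
    by (rule mnorm_cong_AE) (use g'(2) in eventually_elim, simp)
  also have "\<dots> = c * mnorm g'"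
    unfolding mnorm_def by (intro mixed_aux_cmult p_pos g')
  also have "mnorm g' = mnorm g"
    by (rule mnorm_cong_AE) (use g'(2) in eventually_elim, simp)
  finally show ?thesis .
qed

lemma mnorm_suminf:
  assumes "\<And>k::nat. g k \<in> borel_measurable lebesgue"
  shows "mnorm (\<lambda>x. \<Sum>k. g k x) \<le> (\<Sum>k. mnorm (g k))"
proof -
  have "\<forall>k. \<exists>g'. g' \<in> borel_measurable borel \<and> (AE x in lborel. g k x = g' x)"
    using borel_version[OF assms] by metis
  then obtain g' where g': "\<And>k. g' k \<in> borel_measurable borel" "\<And>k. AE x in lborel. g k x = g' k x"
    by metis
  have "AE x in lborel. \<forall>k. g k x = g' k x"
    using g'(2) by (simp add: AE_all_countable)
  then have "mnorm (\<lambda>x. \<Sum>k. g k x) = mnorm (\<lambda>x. \<Sum>k. g' k x)"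
    by (intro mnorm_cong_AE) (auto elim: eventually_mono)
  also have "\<dots> \<le> (\<Sum>k. mnorm (g' k))"
    unfolding mnorm_def by (intro mixed_aux_suminf p_ge_1 g')
  also have "(\<lambda>k. mnorm (g' k)) = (\<lambda>k. mnorm (g k))"
    by (intro ext mnorm_cong_AE[symmetric] g'(2))
  finally show ?thesis .
qed

lemma mnorm_add:
  assumes "g \<in> borel_measurable lebesgue" "h \<in> borel_measurable lebesgue"
  shows "mnorm (\<lambda>x. g x + h x) \<le> mnorm g + mnorm h"
proof -
  from assms(1) obtain g' where g': "g' \<in> borel_measurable borel" "AE x in lborel. g x = g' x"
    by (rule borel_version)
  from assms(2) obtain h' where h': "h' \<in> borel_measurable borel" "AE x in lborel. h x = h' x"
    by (rule borel_version)
  have "mnorm (\<lambda>x. g x + h x) = mnorm (\<lambda>x. g' x + h' x)"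
    by (rule mnorm_cong_AE) (use g'(2) h'(2) in eventually_elim, simp)
  also have "\<dots> \<le> mnorm g' + mnorm h'"
    unfolding mnorm_def by (intro mixed_aux_triangle p_ge_1 g' h')
  also have "mnorm g' = mnorm g"
    by (rule mnorm_cong_AE) (use g'(2) in eventually_elim, simp)
  also have "mnorm h' = mnorm h"
    by (rule mnorm_cong_AE) (use h'(2) in eventually_elim, simp)
  finally show ?thesis .
qed

lemma prod_list_sorted_UNIV: "(\<Prod>i\<leftarrow>sorted_list_of_set UNIV. f i) = (\<Prod>i\<in>(UNIV::'n set). f i :: real)"
  using prod.distinct_set_conv_list[of "sorted_list_of_set (UNIV::'n set)" f] by simp

lemma mnorm_cube:
  assumes "0 < a"
  shows "mnorm (indicator {x. \<forall>j. \<bar>x $ j\<bar> < a}) = ennreal ((2 * a) powr S)"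
proof -
  have "mnorm (indicator {x. \<forall>j\<in>UNIV. \<bar>x $ j\<bar> < a}) = ennreal (\<Prod>i\<in>UNIV. (2 * a) powr (1 / p i))"
    unfolding mnorm_def using assms by (subst mixed_aux_cube) (auto simp: p_pos prod_list_sorted_UNIV)
  also have "(\<Prod>i\<in>UNIV. (2 * a) powr (1 / p i)) = (2 * a) powr S"
    using assms by (simp add: S_def powr_sum)
  finally show ?thesis by simp
qed

lemma mnorm_ball_upper: "0 < r \<Longrightarrow> mnorm (indicator (ball 0 r)) \<le> ennreal ((2 * r) powr S)"
  unfolding mnorm_cube[symmetric]
  by (intro mnorm_mono) (auto simp: indicator_def intro: le_less_trans[OF component_le_norm_cart])

text \<open>The cube of half-side r / n lies in the ball because the l^1 norm dominates the
  Euclidean norm.\<close>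

lemma mnorm_ball_lower:
  assumes "0 < r" shows "ennreal ((2 * (r / n)) powr S) \<le> mnorm (indicator (ball 0 r))"
proof -
  have "norm x < r" if "\<forall>j. \<bar>x $ j\<bar> < r / n" for x :: "(real, 'n) vec"
  proof -
    have "norm x \<le> (\<Sum>j\<in>UNIV. \<bar>x $ j\<bar>)" by (rule norm_le_l1_cart)
    also have "\<dots> < (\<Sum>j\<in>(UNIV :: 'n set). r / n)" using that by (intro sum_strict_mono) auto
    finally show ?thesis by (simp add: n_eq)
  qed
  then show ?thesis
    using assms by (subst mnorm_cube[symmetric]) (auto simp: indicator_def n_eq intro!: mnorm_mono)
qed

lemma mnorm_2_le:
  assumes g: "g \<in> borel_measurable lebesgue" and r: "0 < r" and supp: "\<And>x. r \<le> norm x \<Longrightarrow> g x = 0"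
  shows "epowr (\<integral>\<^sup>+ x. (g x)\<^sup>2 \<partial>lebesgue) (1 / 2) \<le> ennreal (sqrt 2 ^ CARD('n) * (2 * r) powr (n / 2 - S)) * mnorm g"
proof -
  from g obtain g'' where g'': "g'' \<in> borel_measurable borel" "AE x in lborel. g x = g'' x"
    by (rule borel_version)
  \<comment> \<open>The Borel representative may be nonzero outside the ball on a null set; the
    cut-off restores vanishing at every point, as \<open>mixed_aux_2_le\<close> demands.\<close>
  define g' where "g' x = g'' x * indicator (ball 0 r) x" for x
  have [measurable]: "g' \<in> borel_measurable borel"
    unfolding g'_def using g'' by measurable
  have eq: "AE x in lborel. g x = g' x"
    using g''(2) by eventually_elim (use supp in \<open>auto simp: g'_def indicator_def\<close>)
  let ?L = "sorted_list_of_set (UNIV :: 'n set)"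
  have "(\<integral>\<^sup>+ x. (g x)\<^sup>2 \<partial>lebesgue) = (\<integral>\<^sup>+ x. (g' x)\<^sup>2 \<partial>lborel)"
    unfolding nn_integral_completion by (intro nn_integral_cong_AE) (use eq in eventually_elim, simp)
  also have "epowr \<dots> (1 / 2) = mixed_aux (\<lambda>_. 2) ?L g' 0"
    unfolding mixed_aux_2 by (subst mixed_aux_1_eq_nn_integral) (auto simp: epowr_two)
  also have "\<dots> \<le> ennreal (\<Prod>i\<leftarrow>?L. sqrt 2 * (2 * r) powr (1 / 2 - 1 / p i)) * mixed_aux p ?L g' 0"
  proof (intro mixed_aux_2_le p_ge_2 r)
    fix x :: "(real, 'n) vec" and j assume "r \<le> \<bar>x $ j\<bar>"
    with component_le_norm_cart[of x j] show "g' x = 0" by (simp add: g'_def)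
  qed auto
  also have "mixed_aux p ?L g' 0 = mnorm g'" by (simp add: mnorm_def)
  also have "mnorm g' = mnorm g"
    by (rule mnorm_cong_AE) (use eq in eventually_elim, simp)
  also have "(\<Prod>i\<leftarrow>?L. sqrt 2 * (2 * r) powr (1 / 2 - 1 / p i)) = sqrt 2 ^ CARD('n) * (2 * r) powr (n / 2 - S)"
    using r by (simp add: prod_list_sorted_UNIV prod.distrib S_def powr_sum[symmetric] sum_subtractf n_eq)
  finally show ?thesis .
qed

text \<open>Cauchy-Schwarz on the ball, each L^2 norm being bounded by \<open>mnorm_2_le\<close>;
  the two exponents n / 2 - S add up to n - 2 S.\<close>

lemma holder_ball:
  assumes [measurable]: "g \<in> borel_measurable lebesgue" "h \<in> borel_measurable lebesgue" and r: "0 < r"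
  shows "(\<integral>\<^sup>+ x. g x * h x * indicator (ball 0 r) x \<partial>lebesgue) \<le> ennreal (2 ^ CARD('n) * (2 * r) powr (n - 2 * S)) *
    (mnorm (\<lambda>x. g x * indicator (ball 0 r) x) * mnorm (\<lambda>x. h x * indicator (ball 0 r) x))"
proof -
  let ?g = "\<lambda>x. g x * indicator (ball 0 r) x" and ?h = "\<lambda>x. h x * indicator (ball 0 r) x"
  let ?K = "sqrt 2 ^ CARD('n) * (2 * r) powr (n / 2 - S)"
  let ?I = "\<integral>\<^sup>+ x. g x * h x * indicator (ball 0 r) x \<partial>lebesgue"
  have "?I = (\<integral>\<^sup>+ x. ?g x * ?h x \<partial>lebesgue)"
    by (intro nn_integral_cong) (auto simp: indicator_def)
  then have "?I\<^sup>2 \<le> (\<integral>\<^sup>+ x. (?g x)\<^sup>2 \<partial>lebesgue) * (\<integral>\<^sup>+ x. (?h x)\<^sup>2 \<partial>lebesgue)"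
    using Cauchy_Schwarz_nn_integral[of ?g lebesgue ?h] by simp
  then have "epowr (?I\<^sup>2) (1 / 2) \<le> epowr ((\<integral>\<^sup>+ x. (?g x)\<^sup>2 \<partial>lebesgue) * (\<integral>\<^sup>+ x. (?h x)\<^sup>2 \<partial>lebesgue)) (1 / 2)"
    by (rule epowr_mono) simp
  also have "epowr (?I\<^sup>2) (1 / 2) = ?I"
    by (simp add: epowr_two[symmetric] epowr_epowr)
  also have "epowr ((\<integral>\<^sup>+ x. (?g x)\<^sup>2 \<partial>lebesgue) * (\<integral>\<^sup>+ x. (?h x)\<^sup>2 \<partial>lebesgue)) (1 / 2)
      \<le> (ennreal ?K * mnorm ?g) * (ennreal ?K * mnorm ?h)"
    unfolding epowr_mult by (intro mult_mono mnorm_2_le r) auto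
  also have "\<dots> = (ennreal ?K * ennreal ?K) * (mnorm ?g * mnorm ?h)"
    by (simp add: mult_ac)
  also have "ennreal ?K * ennreal ?K = ennreal (2 ^ CARD('n) * (2 * r) powr (n - 2 * S))"
  proof -
    have "?K * ?K = (sqrt 2 * sqrt 2) ^ CARD('n) * ((2 * r) powr (n / 2 - S) * (2 * r) powr (n / 2 - S))"
      unfolding power_mult_distrib by (simp only: mult_ac)
    also have "\<dots> = 2 ^ CARD('n) * (2 * r) powr (n - 2 * S)"
      by (simp flip: powr_add)
    finally show ?thesis by (subst ennreal_mult[symmetric]) auto
  qed
  finally show ?thesis .
qed

end

section \<open>Ball volumes, dyadic scales and integrals of commutator type\<close>

lemma measure_ball_powr:
  assumes "0 < r"
  shows "measure lebesgue (ball (0 :: (real, 'n::finite) vec) r) = unit_ball_vol (real CARD('n)) * r powr real CARD('n)"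
  using assms by (simp add: content_ball powr_realpow)

lemma geometric_suminf:
  fixes R e c :: real
  assumes "e < 0" "0 \<le> c" "0 < R"
  shows "(\<Sum>k. ennreal (c * (R * 2 ^ k) powr e)) = ennreal (c * R powr e / (1 - 2 powr e))"
proof (rule suminf_ennreal_eq)
  have "(\<lambda>k. (c * R powr e) * (2 powr e) ^ k) sums ((c * R powr e) * (1 / (1 - 2 powr e)))"
    using assms by (intro sums_mult geometric_sums) (simp add: powr_less_one)
  moreover have "(2 powr e) ^ k = (2 ^ k) powr e" for k :: nat
    by (simp add: powr_powr mult.commute flip: powr_realpow)
  ultimately show "(\<lambda>k. c * (R * 2 ^ k) powr e) sums (c * R powr e / (1 - 2 powr e))"
    using assms by (simp add: powr_mult mult_ac)
qed (use assms in simp)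

text \<open>The least k with s < r 2^k works: minimality gives the lower bound for k > 0, and r / 2
  \<le> s gives it for k = 0.\<close>

lemma ex_dyadic_above:
  fixes r s :: real
  assumes "0 < r" "r / 2 \<le> s"
  shows "\<exists>k::nat. r * 2 ^ k / 2 \<le> s \<and> s < r * 2 ^ k"
proof -
  have "\<exists>k::nat. s < r * 2 ^ k"
  proof -
    obtain k :: nat where "s / r < 2 ^ k" using real_arch_pow[of 2 "s / r"] by auto
    then show ?thesis using assms by (auto simp: field_simps)
  qed
  then obtain k where k: "s < r * 2 ^ k" "\<And>j. j < k \<Longrightarrow> \<not> s < r * 2 ^ j"
    using exists_least_iff[of "\<lambda>k. s < r * 2 ^ k"] by blast
  then show ?thesis
    using assms by (cases k) (auto intro!: exI[of _ k] simp: not_less)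
qed

lemma ex_dyadic_below:
  fixes R s :: real
  assumes "0 < s" "s < R"
  shows "\<exists>k::nat. R / 2 ^ k / 2 \<le> s \<and> s < R / 2 ^ k"
proof -
  have "\<exists>k::nat. R / 2 ^ k / 2 \<le> s"
  proof -
    obtain k :: nat where "R / s < 2 ^ k" using real_arch_pow[of 2 "R / s"] by auto
    then have "R / 2 ^ k \<le> s" using assms by (auto simp: field_simps)
    then show ?thesis using assms by (intro exI[of _ k]) auto
  qed
  then obtain k where k: "R / 2 ^ k / 2 \<le> s" "\<And>j. j < k \<Longrightarrow> \<not> R / 2 ^ j / 2 \<le> s"
    using exists_least_iff[of "\<lambda>k. R / 2 ^ k / 2 \<le> s"] by blast
  then show ?thesis
    using assms by (cases k) (auto intro!: exI[of _ k] simp: not_le field_simps)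
qed

text \<open>The two bounds make f and (c - b) f integrable on A, which justifies splitting the
  integral of b f as a difference; without integrability the Bochner integral would default to 0 and
  the splitting could fail.\<close>

lemma commutator_integral_bound:
  fixes b f :: "'a \<Rightarrow> real"
  assumes [measurable]: "b \<in> borel_measurable M" "f \<in> borel_measurable M" "A \<in> sets M"
    and fin: "(\<integral>\<^sup>+ t. ennreal \<bar>f t\<bar> * indicator A t \<partial>M) < top"
    and le: "(\<integral>\<^sup>+ t. ennreal (\<bar>c - b t\<bar> * \<bar>f t\<bar>) * indicator A t \<partial>M) \<le> ennreal K" and "0 \<le> K"
  shows "\<bar>c * (LINT t:A|M. f t) - (LINT t:A|M. b t * f t)\<bar> \<le> K"
proof -
  have i1: "set_integrable M A f"
    unfolding set_integrable_def
  proof (rule integrableI_bounded)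
    have "(\<integral>\<^sup>+ t. ennreal (norm (indicator A t *\<^sub>R f t)) \<partial>M) = (\<integral>\<^sup>+ t. ennreal \<bar>f t\<bar> * indicator A t \<partial>M)"
      by (intro nn_integral_cong) (auto simp: indicator_def)
    then show "(\<integral>\<^sup>+ t. ennreal (norm (indicator A t *\<^sub>R f t)) \<partial>M) < \<infinity>" using fin by simp
  qed measurable
  have eq: "(\<integral>\<^sup>+ t. ennreal (norm (indicator A t *\<^sub>R ((c - b t) * f t))) \<partial>M) =
      (\<integral>\<^sup>+ t. ennreal (\<bar>c - b t\<bar> * \<bar>f t\<bar>) * indicator A t \<partial>M)"
    by (intro nn_integral_cong) (auto simp: indicator_def abs_mult)
  have i2: "set_integrable M A (\<lambda>t. (c - b t) * f t)"
    unfolding set_integrable_def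
  proof (rule integrableI_bounded)
    show "(\<integral>\<^sup>+ t. ennreal (norm (indicator A t *\<^sub>R ((c - b t) * f t))) \<partial>M) < \<infinity>"
      unfolding eq using le by (simp add: le_less_trans)
  qed measurable
  have "(LINT t:A|M. b t * f t) = (LINT t:A|M. c * f t - (c - b t) * f t)"
    by (simp add: algebra_simps)
  also have "\<dots> = c * (LINT t:A|M. f t) - (LINT t:A|M. (c - b t) * f t)"
    using i1 i2 by (subst set_integral_diff) (auto simp: set_integrable_mult_right)
  finally have "\<bar>c * (LINT t:A|M. f t) - (LINT t:A|M. b t * f t)\<bar> = \<bar>LINT t:A|M. (c - b t) * f t\<bar>"
    by simp
  also have "ennreal \<dots> \<le> ennreal K"
    using integral_norm_bound_ennreal[OF i2[unfolded set_integrable_def]] le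
    unfolding eq set_lebesgue_integral_def by simp
  ultimately show ?thesis using \<open>0 \<le> K\<close> by simp
qed

section \<open>Morrey and Campanato quotients compared with powers of the radius\<close>

context mixed_exponents
begin

lemma n_pos: "0 < n" by (simp add: n_eq)

lemma S_pos: "0 < S"
  unfolding S_def by (intro sum_pos) (auto simp: p_pos)

abbreviation vol :: real where
  "vol \<equiv> unit_ball_vol n"

lemma vol_pos: "0 < vol" and vol_neq_0: "vol \<noteq> 0"
  using n_pos less_imp_neq[OF unit_ball_vol_pos[of n]] by auto

definition bnorm :: "((real, 'n) vec \<Rightarrow> real) \<Rightarrow> real \<Rightarrow> ennreal" where
  "bnorm f r = mnorm (\<lambda>x. ennreal \<bar>f x\<bar> * indicator (ball 0 r) x)"

lemma mixed_norm_ball: "mixed_norm p (\<lambda>x. f x * indicator (ball 0 r) x) = bnorm f r"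
  unfolding mixed_norm_eq bnorm_def by (intro arg_cong[of _ _ mnorm]) (auto simp: indicator_def)

lemma bnorm_mono_AE:
  "AE x in lborel. norm x < r \<longrightarrow> \<bar>f x\<bar> \<le> \<bar>g x\<bar> \<Longrightarrow> bnorm f r \<le> bnorm g r"
  unfolding bnorm_def
  by (intro mnorm_mono_AE) (auto simp: indicator_def ennreal_leI elim!: eventually_mono)

lemma bnorm_add:
  assumes [measurable]: "f \<in> borel_measurable lebesgue" "g \<in> borel_measurable lebesgue"
  shows "bnorm (\<lambda>x. f x + g x) r \<le> bnorm f r + bnorm g r"
proof -
  have "bnorm (\<lambda>x. f x + g x) r \<le> mnorm (\<lambda>x. ennreal \<bar>f x\<bar> * indicator (ball 0 r) x + ennreal \<bar>g x\<bar> * indicator (ball 0 r) x)"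
    unfolding bnorm_def
    by (intro mnorm_mono) (auto simp: indicator_def ennreal_leI simp flip: ennreal_plus)
  also have "\<dots> \<le> bnorm f r + bnorm g r"
    unfolding bnorm_def by (intro mnorm_add) measurable
  finally show ?thesis .
qed

lemma bnorm_cmult:
  assumes [measurable]: "f \<in> borel_measurable lebesgue"
  shows "bnorm (\<lambda>x. c * f x) r = ennreal \<bar>c\<bar> * bnorm f r"
  unfolding bnorm_def
  by (subst mnorm_cmult[symmetric]) (auto simp: abs_mult ennreal_mult mult.assoc)

lemma bnorm_const_1: "0 < r \<Longrightarrow> bnorm (\<lambda>_. 1) r \<le> ennreal (2 powr S * r powr S)"
  using mnorm_ball_upper[of r] by (simp add: bnorm_def powr_mult)

text \<open>The Morrey and Campanato norms differ only in the numerator N as a function of the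
  radius; this common shape lets one comparison with powers of r serve both.\<close>

definition ball_ratio :: "real \<Rightarrow> (real \<Rightarrow> ennreal) \<Rightarrow> ennreal" where
  "ball_ratio l N = (SUP r\<in>{0<..}. N r / (ennreal (measure lebesgue (ball (0::(real, 'n) vec) r) powr l) * bnorm (\<lambda>_. 1) r))"

lemma morrey_norm_eq: "morrey_norm p l f = ball_ratio l (bnorm f)"
  using mixed_norm_ball[of "\<lambda>_. 1"]
  by (simp add: morrey_norm_def ball_ratio_def mixed_norm_ball)

lemma campanato_norm_eq: "campanato_norm p l f = ball_ratio l (\<lambda>r. bnorm (\<lambda>x. f x - ball_avg f r) r)"
  using mixed_norm_ball[of "\<lambda>_. 1"]
  by (simp add: campanato_norm_def ball_ratio_def mixed_norm_ball)

lemma measure_ball_powr_powr: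
  "0 < r \<Longrightarrow> measure lebesgue (ball (0::(real, 'n) vec) r) powr l = vol powr l * r powr (n * l)"
  using vol_pos by (subst measure_ball_powr) (simp_all add: n_eq powr_mult powr_powr)

text \<open>The circumscribed cube bounds the denominator above by a constant times r^(n l + S). The
  constant is fixed before N and r, so one value serves all functions.\<close>

lemma ball_ratio_lower:
  "\<exists>d>0. \<forall>N r. 0 < r \<longrightarrow> N r \<le> ennreal (d * r powr (n * l + S)) * ball_ratio l N"
proof (intro exI conjI allI impI)
  show "0 < vol powr l * 2 powr S" using vol_pos by simp
  fix N :: "real \<Rightarrow> ennreal" and r :: real assume r: "0 < r"
  let ?D = "ennreal (measure lebesgue (ball (0::(real, 'n) vec) r) powr l) * bnorm (\<lambda>_. 1) r"
  have "0 < ennreal ((2 * (r / n)) powr S)" using r n_pos by simp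
  also have "\<dots> \<le> bnorm (\<lambda>_. 1) r" using mnorm_ball_lower[OF r] by (simp add: bnorm_def)
  finally have "?D \<noteq> 0"
    using r vol_pos by (simp add: measure_ball_powr_powr)
  moreover have le: "?D \<le> ennreal (vol powr l * 2 powr S * r powr (n * l + S))"
  proof -
    have "?D \<le> ennreal (vol powr l * r powr (n * l)) * ennreal (2 powr S * r powr S)"
      unfolding measure_ball_powr_powr[OF r] by (intro mult_left_mono bnorm_const_1 r) auto
    also have "\<dots> = ennreal (vol powr l * 2 powr S * r powr (n * l + S))"
      by (subst ennreal_mult[symmetric]) (auto simp: powr_add mult_ac)
    finally show ?thesis .
  qed
  then have "?D \<noteq> top" by (auto simp: top_unique)
  \<comment> \<open>Dividing and multiplying back is legitimate in \<open>ennreal\<close> because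
    the denominator is neither 0 nor \<open>top\<close>.\<close>
  ultimately have "N r = ?D * (N r / ?D)"
    by (simp add: ennreal_times_divide mult_divide_eq_ennreal mult.commute)
  also have "\<dots> \<le> ennreal (vol powr l * 2 powr S * r powr (n * l + S)) * ball_ratio l N"
    unfolding ball_ratio_def using r by (intro mult_mono le SUP_upper) auto
  finally show "N r \<le> ennreal (vol powr l * 2 powr S * r powr (n * l + S)) * ball_ratio l N" .
qed

text \<open>Here the inscribed cube bounds the denominator from below, again with a constant
  independent of N and K.\<close>

lemma ball_ratio_upper:
  "\<exists>c>0. \<forall>N K. (\<forall>r>0. N r \<le> K * ennreal (r powr (n * l + S))) \<longrightarrow> ball_ratio l N \<le> ennreal c * K"
proof (intro exI conjI allI impI)
  let ?c = "vol powr l * (2 / n) powr S"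
  show c: "0 < 1 / ?c" using vol_neq_0 n_pos by simp
  fix N :: "real \<Rightarrow> ennreal" and K assume N: "\<forall>r>0. N r \<le> K * ennreal (r powr (n * l + S))"
  show "ball_ratio l N \<le> ennreal (1 / ?c) * K"
    unfolding ball_ratio_def
  proof (intro SUP_least)
    fix r :: real assume "r \<in> {0<..}"
    then have r: "0 < r" by simp
    let ?D = "ennreal (measure lebesgue (ball (0::(real, 'n) vec) r) powr l) * bnorm (\<lambda>_. 1) r"
    have "ennreal (?c * r powr (n * l + S)) = ennreal (vol powr l * r powr (n * l)) * ennreal ((2 * (r / n)) powr S)"
      using r n_pos by (subst ennreal_mult[symmetric]) (auto simp: powr_add powr_mult powr_divide)
    also have "\<dots> \<le> ?D"
      unfolding measure_ball_powr_powr[OF r] using mnorm_ball_lower[OF r]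
      by (intro mult_left_mono) (auto simp: bnorm_def)
    finally have D: "ennreal (?c * r powr (n * l + S)) \<le> ?D" .
    have pos: "0 < ennreal (?c * r powr (n * l + S))" using c r by simp
    have "N r \<le> K * ennreal (r powr (n * l + S))" using N r by simp
    also have "r powr (n * l + S) = (1 / ?c) * (?c * r powr (n * l + S))" using vol_neq_0 n_pos by simp
    also have "K * ennreal \<dots> = ennreal (?c * r powr (n * l + S)) * (ennreal (1 / ?c) * K)"
      using c by (subst ennreal_mult) (auto simp: mult_ac)
    also have "\<dots> \<le> ?D * (ennreal (1 / ?c) * K)"
      by (intro mult_right_mono D) auto
    finally show "N r / ?D \<le> ennreal (1 / ?c) * K"
      by (intro divide_le_posI_ennreal less_le_trans[OF pos D])
  qed
qed

text \<open>The part of the constant in \<open>holder_ball\<close> that is left after r^(n - 2 S) is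
  split off.\<close>

definition hc :: real where
  "hc = 2 ^ CARD('n) * 2 powr (n - 2 * S)"

lemma hc_pos: "0 < hc"
  by (simp add: hc_def)

text \<open>With growth exponents l + S and m + S for the two factors, S cancels against n - 2 S and
  the bound scales as r^(n + l + m).\<close>

lemma nn_integral_product_le:
  assumes [measurable]: "f \<in> borel_measurable lebesgue" "g \<in> borel_measurable lebesgue" and r: "0 < r"
    and f: "bnorm f r \<le> ennreal (F * r powr (l + S))" and g: "bnorm g r \<le> ennreal (G * r powr (m + S))"
    and FG: "0 \<le> F" "0 \<le> G"
  shows "(\<integral>\<^sup>+ x. ennreal (\<bar>f x\<bar> * \<bar>g x\<bar>) * indicator (ball 0 r) x \<partial>lebesgue) \<le> ennreal (hc * F * G * r powr (n + l + m))"
proof -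
  have "(\<integral>\<^sup>+ x. ennreal (\<bar>f x\<bar> * \<bar>g x\<bar>) * indicator (ball 0 r) x \<partial>lebesgue) \<le>
      ennreal (2 ^ CARD('n) * (2 * r) powr (n - 2 * S)) * (bnorm f r * bnorm g r)"
    using holder_ball[of "\<lambda>x. ennreal \<bar>f x\<bar>" "\<lambda>x. ennreal \<bar>g x\<bar>" r] r by (simp add: bnorm_def ennreal_mult)
  also have "\<dots> \<le> ennreal (2 ^ CARD('n) * (2 * r) powr (n - 2 * S)) * (ennreal (F * r powr (l + S)) * ennreal (G * r powr (m + S)))"
    by (intro mult_left_mono mult_mono f g) auto
  also have "\<dots> = ennreal (2 ^ CARD('n) * (2 * r) powr (n - 2 * S) * (F * r powr (l + S) * (G * r powr (m + S))))"
    using FG by (subst ennreal_mult[symmetric]; simp)+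
  also have "2 ^ CARD('n) * (2 * r) powr (n - 2 * S) * (F * r powr (l + S) * (G * r powr (m + S))) =
      2 ^ CARD('n) * 2 powr (n - 2 * S) * (F * G * (r powr (n - 2 * S) * (r powr (l + S) * r powr (m + S))))"
    using r by (simp add: powr_mult)
  also have "r powr (n - 2 * S) * (r powr (l + S) * r powr (m + S)) = r powr (n + l + m)"
    by (simp flip: powr_add) (simp add: algebra_simps)
  finally show ?thesis by (simp add: hc_def mult.assoc)
qed

text \<open>The second factor is the constant 1, whose norm on the ball grows like r^S, so that m =
  0 in \<open>nn_integral_product_le\<close>.\<close>

lemma nn_integral_single_le:
  assumes [measurable]: "f \<in> borel_measurable lebesgue" and r: "0 < r"
    and f: "bnorm f r \<le> ennreal (F * r powr (l + S))" and F: "0 \<le> F"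
  shows "(\<integral>\<^sup>+ x. ennreal \<bar>f x\<bar> * indicator (ball 0 r) x \<partial>lebesgue) \<le> ennreal (hc * 2 powr S * F * r powr (n + l))"
  using nn_integral_product_le[of f "\<lambda>_. 1" r F l "2 powr S" 0] bnorm_const_1[OF r] assms by (simp add: mult_ac)

end

section \<open>Pointwise bounds for the commutators\<close>

lemma locally_integrable_ball: "locally_integrable b \<Longrightarrow> set_integrable lebesgue (ball 0 r) b"
  unfolding locally_integrable_def
  by (rule set_integrable_subset[of _ "cball 0 r"]) auto

text \<open>The parameter conditions are kept as conditions on exponents of the radius:
  \<open>lam_S\<close> makes the sum over shrinking annuli converge, \<open>beta_S\<close> puts the
  test functions into the Morrey space, \<open>alpha_less\<close> makes the kernel decrease, and
  \<open>beta_eq\<close> balances the powers of r.\<close>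

locale hardy_exponents = mixed_exponents p n
  for p :: "'n::{finite,linorder} \<Rightarrow> real" and n :: real +
  fixes lam \<alpha> \<beta> :: real
  assumes lam_neg: "lam < 0" and lam_S: "0 < 2 * (n * lam) + S"
    and alpha_pos: "0 < \<alpha>" and alpha_less: "\<alpha> < n"
    and beta_S: "0 < n * \<beta> + S" and beta_eq: "n * \<beta> = n * lam - \<alpha>"
begin

lemma nlam_neg: "n * lam < 0"
  using lam_neg n_pos by (simp add: mult_pos_neg)

lemma nlam_ratio: "2 powr (n * lam) < 1" "2 powr (2 * (n * lam)) < 1"
  using nlam_neg powr_less_one[of 2 "n * lam"] powr_less_one[of 2 "2 * (n * lam)"] by linarith+

text \<open>The punctured ball is cut into annuli of outer radius R / 2^k, on each of which T is
  dominated by data of the ball of that radius. The k-th norm is of order (R / 2^k)^(2 n lam + S), a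
  geometric sequence.\<close>

lemma annular_bound:
  fixes b T :: "(real, 'n) vec \<Rightarrow> real" and avg :: "real \<Rightarrow> real"
  assumes [measurable]: "b \<in> borel_measurable lebesgue"
    and G: "0 \<le> G" "\<And>r. 0 < r \<Longrightarrow> bnorm (\<lambda>x. b x - avg r) r \<le> ennreal (G * r powr (n * lam + S))"
    and K: "0 \<le> K"
    and T: "\<And>x r. 0 < r \<Longrightarrow> r / 2 \<le> norm x \<Longrightarrow> norm x < r \<Longrightarrow>
       \<bar>T x\<bar> \<le> K * (\<bar>b x - avg r\<bar> * r powr (n * lam) + G * r powr (2 * (n * lam)))"
    and R: "0 < R"
  shows "bnorm T R \<le> ennreal (K * G * (1 + 2 powr S) / (1 - 2 powr - (2 * (n * lam) + S)) * R powr (2 * (n * lam) + S))"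
proof -
  define e where "e = 2 * (n * lam) + S"
  define r where "r k = R / 2 ^ k" for k :: nat
  have r: "0 < r k" for k using R by (simp add: r_def)
  let ?b = "\<lambda>k x. ennreal \<bar>b x - avg (r k)\<bar> * indicator (ball 0 (r k)) x"
  define g where "g k x = ennreal (K * r k powr (n * lam)) * ?b k x
     + ennreal (K * G * r k powr (2 * (n * lam))) * indicator (ball 0 (r k)) x" for k x
  have [measurable]: "g k \<in> borel_measurable lebesgue" for k
    unfolding g_def by measurable
  \<comment> \<open>The origin lies in no annulus, so domination by the series is claimed only off
    this null set.\<close>
  have "AE x in lborel. x \<noteq> (0 :: (real, 'n) vec)"
    by (rule AE_lborel_singleton)
  then have "AE x in lborel. ennreal \<bar>T x\<bar> * indicator (ball 0 R) x \<le> (\<Sum>k. g k x)"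
  proof eventually_elim
    case (elim x)
    show ?case
    proof (cases "norm x < R")
      case True
      obtain k where k: "r k / 2 \<le> norm x" "norm x < r k"
        using ex_dyadic_below[of "norm x" R] elim True unfolding r_def by auto
      have "ennreal \<bar>T x\<bar> \<le> ennreal (K * (\<bar>b x - avg (r k)\<bar> * r k powr (n * lam) + G * r k powr (2 * (n * lam))))"
        using T[OF r k] by (rule ennreal_leI)
      also have "\<dots> = g k x"
        using k G K by (simp add: g_def distrib_left mult_ac flip: ennreal_mult ennreal_plus)
      also have "\<dots> \<le> (\<Sum>k. g k x)"
        using sum_le_suminf[of "\<lambda>k. g k x" "{k}"] by simp
      finally show ?thesis using True by simp
    qed simp
  qed
  then have "bnorm T R \<le> mnorm (\<lambda>x. \<Sum>k. g k x)"
    unfolding bnorm_def by (rule mnorm_mono_AE)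
  also have "\<dots> \<le> (\<Sum>k. mnorm (g k))"
    by (rule mnorm_suminf) measurable
  \<comment> \<open>The shrinking radii are rewritten as growing ones, (1 / R) 2^k, with a negative
    exponent, to fit \<open>geometric_suminf\<close>.\<close>
  also have "\<dots> \<le> (\<Sum>k. ennreal (K * G * (1 + 2 powr S) * (1 / R * 2 ^ k) powr - e))"
  proof (rule suminf_le)
    fix k
    have "mnorm (g k) \<le> mnorm (\<lambda>x. ennreal (K * r k powr (n * lam)) * ?b k x)
       + mnorm (\<lambda>x. ennreal (K * G * r k powr (2 * (n * lam))) * indicator (ball 0 (r k)) x)"
      unfolding g_def by (intro mnorm_add) measurable
    also have "\<dots> = ennreal (K * r k powr (n * lam)) * bnorm (\<lambda>x. b x - avg (r k)) (r k)
       + ennreal (K * G * r k powr (2 * (n * lam))) * bnorm (\<lambda>_. 1) (r k)"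
      unfolding bnorm_def by (subst (1 2) mnorm_cmult) (simp_all, measurable)
    also have "\<dots> \<le> ennreal (K * r k powr (n * lam)) * ennreal (G * r k powr (n * lam + S))
       + ennreal (K * G * r k powr (2 * (n * lam))) * ennreal (2 powr S * r k powr S)"
      by (intro add_mono mult_left_mono G bnorm_const_1 r) auto
    also have "\<dots> = ennreal (K * r k powr (n * lam) * (G * r k powr (n * lam + S)) + K * G * r k powr (2 * (n * lam)) * (2 powr S * r k powr S))"
      using G K by (simp flip: ennreal_mult ennreal_plus)
    also have "K * r k powr (n * lam) * (G * r k powr (n * lam + S)) + K * G * r k powr (2 * (n * lam)) * (2 powr S * r k powr S)
       = K * G * (1 + 2 powr S) * r k powr e"
    proof -
      have "r k powr (n * lam) * r k powr (n * lam + S) = r k powr e" "r k powr (2 * (n * lam)) * r k powr S = r k powr e"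
        by (simp_all only: e_def powr_add[symmetric] mult_2 add.assoc)
      then show ?thesis by (simp add: mult_ac distrib_left)
    qed
    also have "r k powr e = (1 / R * 2 ^ k) powr - e"
      using R by (simp add: r_def powr_minus powr_divide divide_simps)
    finally show "mnorm (g k) \<le> ennreal (K * G * (1 + 2 powr S) * (1 / R * 2 ^ k) powr - e)" .
  qed auto
  also have "\<dots> = ennreal (K * G * (1 + 2 powr S) * (1 / R) powr - e / (1 - 2 powr - e))"
    using R G K lam_S by (intro geometric_suminf) (auto simp: e_def)
  also have "K * G * (1 + 2 powr S) * (1 / R) powr - e / (1 - 2 powr - e) = K * G * (1 + 2 powr S) / (1 - 2 powr - e) * R powr e"
    using R by (simp add: powr_minus powr_divide)
  finally show ?thesis by (simp add: e_def)
qed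

text \<open>The difference is the mean over the smaller ball of b minus its average over the larger
  one. Enlarging the domain of integration bounds it by the oscillation on the larger ball.\<close>

lemma ball_avg_diff:
  fixes b :: "(real, 'n) vec \<Rightarrow> real"
  assumes b: "locally_integrable b" and [measurable]: "b \<in> borel_measurable lebesgue"
    and G: "0 \<le> G" "\<And>r. 0 < r \<Longrightarrow> bnorm (\<lambda>x. b x - ball_avg b r) r \<le> ennreal (G * r powr (n * lam + S))"
    and r: "0 < r"
  shows "\<bar>ball_avg b r - ball_avg b (2 * r)\<bar> \<le> hc * 2 powr S * 2 powr (n + n * lam) / vol * G * r powr (n * lam)"
proof -
  let ?B = "ball (0 :: (real, 'n) vec) r" and ?a = "ball_avg b (2 * r)"
  have m: "measure lebesgue ?B = vol * r powr n"
    using r by (subst measure_ball_powr) (simp_all add: n_eq)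
  have i: "set_integrable lebesgue ?B b"
    by (rule locally_integrable_ball[OF b])
  have ic: "set_integrable lebesgue ?B (\<lambda>_. c :: real)" for c
    using emeasure_bounded_finite[of ?B]
    by (auto simp: set_integrable_def intro!: integrable_real_mult_indicator)
  have "(LINT t:?B|lebesgue. b t - ?a) = (LINT t:?B|lebesgue. b t) - (LINT t:?B|lebesgue. ?a)"
    by (rule set_integral_diff(2)[OF i ic])
  also have "(LINT t:?B|lebesgue. ?a) = ?a * measure lebesgue ?B"
    unfolding set_lebesgue_integral_def by simp
  finally have "ball_avg b r - ?a = (LINT t:?B|lebesgue. b t - ?a) / (vol * r powr n)"
    unfolding ball_avg_def[of b r] m using vol_pos r by (simp add: field_simps)
  then have 1: "\<bar>ball_avg b r - ?a\<bar> = \<bar>LINT t:?B|lebesgue. b t - ?a\<bar> / (vol * r powr n)"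
    using vol_pos r by (simp add: abs_mult)
  have "ennreal \<bar>LINT t:?B|lebesgue. b t - ?a\<bar> \<le> (\<integral>\<^sup>+ t. ennreal (norm (indicator ?B t *\<^sub>R (b t - ?a))) \<partial>lebesgue)"
    using integral_norm_bound_ennreal[of lebesgue "\<lambda>t. indicator ?B t *\<^sub>R (b t - ?a)"] set_integral_diff(1)[OF i ic, of ?a]
    unfolding set_integrable_def set_lebesgue_integral_def by simp
  also have "\<dots> \<le> (\<integral>\<^sup>+ t. ennreal \<bar>b t - ?a\<bar> * indicator (ball 0 (2 * r)) t \<partial>lebesgue)"
    using r by (intro nn_integral_mono) (auto simp: indicator_def)
  also have "\<dots> \<le> ennreal (hc * 2 powr S * G * (2 * r) powr (n + n * lam))"
    using r G by (intro nn_integral_single_le) auto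
  finally have "\<bar>LINT t:?B|lebesgue. b t - ?a\<bar> \<le> hc * 2 powr S * G * (2 * r) powr (n + n * lam)"
    using hc_pos G by (subst (asm) ennreal_le_iff) auto
  then have "\<bar>ball_avg b r - ?a\<bar> \<le> hc * 2 powr S * G * (2 * r) powr (n + n * lam) / (vol * r powr n)"
    unfolding 1 using vol_pos r by (intro divide_right_mono) auto
  also have "\<dots> = hc * 2 powr S * 2 powr (n + n * lam) / vol * G * r powr (n * lam)"
    using r by (simp add: powr_mult powr_add)
  finally show ?thesis .
qed

text \<open>Telescoping over consecutive doublings gives a geometric sum with ratio 2^(n lam) < 1.
  The bound is therefore uniform in j, which allows averages at all scales to be compared with the
  first.\<close>

lemma ball_avg_dyadic_diff:
  fixes b :: "(real, 'n) vec \<Rightarrow> real"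
  assumes b: "locally_integrable b" and [measurable]: "b \<in> borel_measurable lebesgue"
    and G: "0 \<le> G" "\<And>r. 0 < r \<Longrightarrow> bnorm (\<lambda>x. b x - ball_avg b r) r \<le> ennreal (G * r powr (n * lam + S))"
    and r: "0 < r"
  shows "\<bar>ball_avg b r - ball_avg b (r * 2 ^ j)\<bar> \<le>
     hc * 2 powr S * 2 powr (n + n * lam) / vol / (1 - 2 powr (n * lam)) * (G * r powr (n * lam))"
proof -
  define c where "c = hc * 2 powr S * 2 powr (n + n * lam) / vol"
  have c: "0 \<le> c" using hc_pos vol_pos by (simp add: c_def)
  let ?q = "2 powr (n * lam)"
  have "\<bar>ball_avg b r - ball_avg b (r * 2 ^ j)\<bar> \<le> c * G * r powr (n * lam) * (\<Sum>i<j. ?q ^ i)" for j :: nat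
  proof (induction j)
    case (Suc j)
    have "\<bar>ball_avg b (r * 2 ^ j) - ball_avg b (r * 2 ^ Suc j)\<bar> \<le> c * G * (r * 2 ^ j) powr (n * lam)"
      using ball_avg_diff[OF b assms(2) G, of "r * 2 ^ j"] r by (simp add: c_def mult_ac)
    also have "(r * 2 ^ j) powr (n * lam) = r powr (n * lam) * ?q ^ j"
      using r by (simp add: powr_mult powr_powr mult.commute flip: powr_realpow)
    finally show ?case using Suc.IH by (simp add: algebra_simps)
  qed simp
  also have "c * G * r powr (n * lam) * (\<Sum>i<j. ?q ^ i) \<le> c * G * r powr (n * lam) * (1 / (1 - ?q))"
  proof (intro mult_left_mono)
    have "(\<Sum>i<j. ?q ^ i) \<le> (\<Sum>i. ?q ^ i)"
      using nlam_ratio by (intro sum_le_suminf summable_geometric) auto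
    then show "(\<Sum>i<j. ?q ^ i) \<le> 1 / (1 - ?q)"
      using nlam_ratio by (simp add: suminf_geometric)
  qed (use c G in auto)
  finally show ?thesis by (simp add: c_def mult_ac)
qed

lemma powr_kernel_le:
  assumes "0 < r" "r / 2 \<le> s"
  shows "s powr (\<alpha> - n) \<le> 2 powr (n - \<alpha>) * r powr (\<alpha> - n)"
proof -
  have "s powr (\<alpha> - n) \<le> (r / 2) powr (\<alpha> - n)"
    using assms alpha_less by (intro powr_mono2') auto
  also have "\<dots> = 2 powr (n - \<alpha>) * r powr (\<alpha> - n)"
    using assms by (simp add: powr_divide powr_diff)
  finally show ?thesis .
qed

text \<open>The difference b x - b t is split at \<open>avg r\<close> and the integration enlarged
  from radius |x| to r. The two integrals scale as r^(n + n beta) and r^(n + n lam + n beta); the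
  kernel factor r^(alpha - n) and \<open>beta_eq\<close> turn these into r^(n lam) and r^(2 n
  lam).\<close>

lemma hardy_comm_pointwise:
  fixes b f :: "(real, 'n) vec \<Rightarrow> real" and avg :: "real \<Rightarrow> real"
  assumes [measurable]: "b \<in> borel_measurable lebesgue" "f \<in> borel_measurable lebesgue"
    and G: "0 \<le> G" "\<And>r. 0 < r \<Longrightarrow> bnorm (\<lambda>x. b x - avg r) r \<le> ennreal (G * r powr (n * lam + S))"
    and F: "0 \<le> F" "\<And>r. 0 < r \<Longrightarrow> bnorm f r \<le> ennreal (F * r powr (n * \<beta> + S))"
    and x: "0 < r" "r / 2 \<le> norm x" "norm x < r"
  shows "\<bar>hardy_comm \<alpha> b f x\<bar> \<le> 2 powr (n - \<alpha>) * hc * (1 + 2 powr S) * F *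
     (\<bar>b x - avg r\<bar> * r powr (n * lam) + G * r powr (2 * (n * lam)))"
proof -
  define D where "D = \<bar>b x - avg r\<bar>"
  have D: "0 \<le> D" by (simp add: D_def)
  let ?B = "ball (0 :: (real, 'n) vec) (norm x)"
  have f: "(\<integral>\<^sup>+ t. ennreal \<bar>f t\<bar> * indicator (ball 0 r) t \<partial>lebesgue) \<le> ennreal (hc * 2 powr S * F * r powr (n + n * \<beta>))"
    using F x by (intro nn_integral_single_le) auto
  have bf: "(\<integral>\<^sup>+ t. ennreal (\<bar>b t - avg r\<bar> * \<bar>f t\<bar>) * indicator (ball 0 r) t \<partial>lebesgue)
     \<le> ennreal (hc * G * F * r powr (n + n * lam + n * \<beta>))"
    using F G x by (intro nn_integral_product_le) auto
  have "\<bar>b x * (LINT t:?B|lebesgue. f t) - (LINT t:?B|lebesgue. b t * f t)\<bar> \<le>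
      D * (hc * 2 powr S * F * r powr (n + n * \<beta>)) + hc * G * F * r powr (n + n * lam + n * \<beta>)"
  proof (rule commutator_integral_bound)
    have "(\<integral>\<^sup>+ t. ennreal \<bar>f t\<bar> * indicator ?B t \<partial>lebesgue) \<le> (\<integral>\<^sup>+ t. ennreal \<bar>f t\<bar> * indicator (ball 0 r) t \<partial>lebesgue)"
      using x by (intro nn_integral_mono) (auto simp: indicator_def)
    also have "\<dots> < top" using f by (rule le_less_trans) simp
    finally show "(\<integral>\<^sup>+ t. ennreal \<bar>f t\<bar> * indicator ?B t \<partial>lebesgue) < top" .
    have "(\<integral>\<^sup>+ t. ennreal (\<bar>b x - b t\<bar> * \<bar>f t\<bar>) * indicator ?B t \<partial>lebesgue) \<le>
      (\<integral>\<^sup>+ t. ennreal D * (ennreal \<bar>f t\<bar> * indicator (ball 0 r) t) +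
          ennreal (\<bar>b t - avg r\<bar> * \<bar>f t\<bar>) * indicator (ball 0 r) t \<partial>lebesgue)"
    proof (intro nn_integral_mono)
      fix t :: "(real, 'n) vec"
      have "\<bar>b x - b t\<bar> * \<bar>f t\<bar> \<le> (D + \<bar>b t - avg r\<bar>) * \<bar>f t\<bar>"
        unfolding D_def by (intro mult_right_mono) auto
      then show "ennreal (\<bar>b x - b t\<bar> * \<bar>f t\<bar>) * indicator ?B t \<le> ennreal D * (ennreal \<bar>f t\<bar> * indicator (ball 0 r) t) +
          ennreal (\<bar>b t - avg r\<bar> * \<bar>f t\<bar>) * indicator (ball 0 r) t"
        using x D by (auto simp: indicator_def distrib_right ennreal_leI simp flip: ennreal_mult ennreal_plus)
    qed
    also have "\<dots> = ennreal D * (\<integral>\<^sup>+ t. ennreal \<bar>f t\<bar> * indicator (ball 0 r) t \<partial>lebesgue) +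
       (\<integral>\<^sup>+ t. ennreal (\<bar>b t - avg r\<bar> * \<bar>f t\<bar>) * indicator (ball 0 r) t \<partial>lebesgue)"
      by (subst nn_integral_add, measurable) (subst nn_integral_cmult, measurable)
    also have "\<dots> \<le> ennreal D * ennreal (hc * 2 powr S * F * r powr (n + n * \<beta>)) + ennreal (hc * G * F * r powr (n + n * lam + n * \<beta>))"
      by (intro add_mono mult_left_mono f bf) auto
    finally show "(\<integral>\<^sup>+ t. ennreal (\<bar>b x - b t\<bar> * \<bar>f t\<bar>) * indicator ?B t \<partial>lebesgue) \<le>
        ennreal (D * (hc * 2 powr S * F * r powr (n + n * \<beta>)) + hc * G * F * r powr (n + n * lam + n * \<beta>))"
      using D F G hc_pos by (simp add: ennreal_mult ennreal_plus)
  qed (use D F G hc_pos in auto)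
  also have "\<dots> \<le> hc * (1 + 2 powr S) * F * (D * r powr (n + n * \<beta>) + G * r powr (n + n * lam + n * \<beta>))"
  proof -
    \<comment> \<open>These are the cross terms missing from the left side; adding them makes
      \<open>hc * (1 + 2 powr S) * F\<close> a common factor.\<close>
    have "0 \<le> hc * F * D * r powr (n + n * \<beta>)" "0 \<le> hc * F * 2 powr S * G * r powr (n + n * lam + n * \<beta>)"
      using D F G hc_pos by auto
    then show ?thesis by (simp add: algebra_simps)
  qed
  finally have *: "\<bar>b x * (LINT t:?B|lebesgue. f t) - (LINT t:?B|lebesgue. b t * f t)\<bar> \<le> \<dots>" .
  have "hardy_comm \<alpha> b f x = norm x powr (\<alpha> - n) * (b x * (LINT t:?B|lebesgue. f t) - (LINT t:?B|lebesgue. b t * f t))"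
    by (simp add: hardy_comm_def hardy_def n_eq algebra_simps)
  then have "\<bar>hardy_comm \<alpha> b f x\<bar> = norm x powr (\<alpha> - n) * \<bar>b x * (LINT t:?B|lebesgue. f t) - (LINT t:?B|lebesgue. b t * f t)\<bar>"
    by (simp add: abs_mult)
  also have "\<dots> \<le> (2 powr (n - \<alpha>) * r powr (\<alpha> - n)) * (hc * (1 + 2 powr S) * F * (D * r powr (n + n * \<beta>) + G * r powr (n + n * lam + n * \<beta>)))"
    using x by (intro mult_mono * powr_kernel_le) auto
  also have "\<dots> = 2 powr (n - \<alpha>) * hc * (1 + 2 powr S) * F *
     (D * (r powr (\<alpha> - n) * r powr (n + n * \<beta>)) + G * (r powr (\<alpha> - n) * r powr (n + n * lam + n * \<beta>)))"
    by (simp add: algebra_simps)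
  also have "r powr (\<alpha> - n) * r powr (n + n * \<beta>) = r powr (n * lam)"
    by (simp add: beta_eq flip: powr_add)
  also have "r powr (\<alpha> - n) * r powr (n + n * lam + n * \<beta>) = r powr (2 * (n * lam))"
    using beta_eq by (simp only: powr_add[symmetric]) (simp add: mult.commute[of n])
  finally show ?thesis by (simp add: D_def)
qed

text \<open>The exterior region is covered by dyadic annuli, on each of which the kernel is
  comparable to a constant. The majorant H may vary with j, so that a different average of b can be
  subtracted at each scale.\<close>

lemma nn_integral_tail_le:
  fixes h :: "(real, 'n) vec \<Rightarrow> real" and H :: "nat \<Rightarrow> (real, 'n) vec \<Rightarrow> ennreal"
  assumes [measurable]: "\<And>j. H j \<in> borel_measurable lebesgue"
    and h: "\<And>j t. ennreal \<bar>h t\<bar> \<le> H j t" and r: "0 < r" "r / 2 \<le> \<rho>"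
  shows "(\<integral>\<^sup>+ t. ennreal (\<bar>h t\<bar> * norm t powr (\<alpha> - n)) * indicator {t. \<rho> \<le> norm t} t \<partial>lebesgue) \<le>
    (\<Sum>j. ennreal (2 powr (n - \<alpha>) * (r * 2 ^ j) powr (\<alpha> - n)) * (\<integral>\<^sup>+ t. H j t * indicator (ball 0 (r * 2 ^ j)) t \<partial>lebesgue))"
proof -
  let ?c = "\<lambda>j. 2 powr (n - \<alpha>) * (r * 2 ^ j) powr (\<alpha> - n)"
  let ?H = "\<lambda>j t. ennreal (?c j) * (H j t * indicator (ball 0 (r * 2 ^ j)) t)"
  have "(\<integral>\<^sup>+ t. ennreal (\<bar>h t\<bar> * norm t powr (\<alpha> - n)) * indicator {t. \<rho> \<le> norm t} t \<partial>lebesgue) \<le> (\<integral>\<^sup>+ t. (\<Sum>j. ?H j t) \<partial>lebesgue)"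
  proof (intro nn_integral_mono)
    fix t :: "(real, 'n) vec"
    show "ennreal (\<bar>h t\<bar> * norm t powr (\<alpha> - n)) * indicator {t. \<rho> \<le> norm t} t \<le> (\<Sum>j. ?H j t)"
    proof (cases "\<rho> \<le> norm t")
      case True
      then obtain j where j: "r * 2 ^ j / 2 \<le> norm t" "norm t < r * 2 ^ j"
        using ex_dyadic_above[of r "norm t"] r by auto
      have "ennreal (\<bar>h t\<bar> * norm t powr (\<alpha> - n)) = ennreal (norm t powr (\<alpha> - n)) * ennreal \<bar>h t\<bar>"
        by (simp add: ennreal_mult mult.commute)
      also have "\<dots> \<le> ennreal (?c j) * H j t"
        using j r by (intro mult_mono h ennreal_leI powr_kernel_le) auto
      also have "\<dots> = ?H j t" using j by simp
      also have "\<dots> \<le> (\<Sum>j. ?H j t)"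
        using sum_le_suminf[of "\<lambda>j. ?H j t" "{j}"] by simp
      finally show ?thesis using True by simp
    qed simp
  qed
  also have "\<dots> = (\<Sum>j. \<integral>\<^sup>+ t. ?H j t \<partial>lebesgue)"
    by (intro nn_integral_suminf) measurable
  also have "\<dots> = (\<Sum>j. ennreal (?c j) * (\<integral>\<^sup>+ t. H j t * indicator (ball 0 (r * 2 ^ j)) t \<partial>lebesgue))"
    by (intro suminf_cong nn_integral_cmult) measurable
  finally show ?thesis .
qed

definition osc_const :: real where
  "osc_const = hc * 2 powr S * 2 powr (n + n * lam) / vol / (1 - 2 powr (n * lam))"

text \<open>The denominators come from two geometric sums: ratio 2^(n lam) for the part measured
  against b x, and ratio 2^(2 n lam) for the local oscillation of b.\<close>

definition adj_const :: real where
  "adj_const = 2 powr (n - \<alpha>) * hc * (1 + 2 powr S) * ((1 + osc_const) / (1 - 2 powr (n * lam)) + 1 / (1 - 2 powr (2 * (n * lam))))"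

lemma osc_const_nonneg: "0 \<le> osc_const"
  unfolding osc_const_def using hc_pos vol_pos nlam_ratio by (intro divide_nonneg_nonneg mult_nonneg_nonneg) auto

lemma adj_const_nonneg: "0 \<le> adj_const"
  unfolding adj_const_def using hc_pos osc_const_nonneg nlam_ratio
  by (intro mult_nonneg_nonneg add_nonneg_nonneg divide_nonneg_nonneg) auto

text \<open>On the j-th annulus b x - b t is split at the averages over the balls of radius r and r
  2^j. The first two pieces are bounded uniformly in j, the third is an oscillation, and both
  resulting series converge because lam < 0.\<close>

lemma hardy_adj_comm_pointwise:
  fixes b f :: "(real, 'n) vec \<Rightarrow> real"
  assumes b: "locally_integrable b" and [measurable]: "b \<in> borel_measurable lebesgue" "f \<in> borel_measurable lebesgue"
    and G: "0 \<le> G" "\<And>r. 0 < r \<Longrightarrow> bnorm (\<lambda>x. b x - ball_avg b r) r \<le> ennreal (G * r powr (n * lam + S))"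
    and F: "0 \<le> F" "\<And>r. 0 < r \<Longrightarrow> bnorm f r \<le> ennreal (F * r powr (n * \<beta> + S))"
    and x: "0 < r" "r / 2 \<le> norm x" "norm x < r"
  shows "\<bar>hardy_adj_comm \<alpha> b f x\<bar> \<le> adj_const * F *
     (\<bar>b x - ball_avg b r\<bar> * r powr (n * lam) + G * r powr (2 * (n * lam)))"
proof -
  define D where "D = \<bar>b x - ball_avg b r\<bar>"
  \<comment> \<open>By \<open>ball_avg_dyadic_diff\<close>, E bounds the distance from b x to the
    averages over all balls of radius r 2^j at once.\<close>
  define E where "E = D + osc_const * (G * r powr (n * lam))"
  have D: "0 \<le> D" by (simp add: D_def)
  have E: "0 \<le> E" using D G osc_const_nonneg by (simp add: E_def)
  let ?A = "{t :: (real, 'n) vec. norm x \<le> norm t}"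
  let ?w = "\<lambda>t :: (real, 'n) vec. norm t powr (\<alpha> - n)"
  let ?r = "\<lambda>j :: nat. r * 2 ^ j"
  let ?c = "\<lambda>j :: nat. 2 powr (n - \<alpha>) * ?r j powr (\<alpha> - n)"
  have rj: "0 < ?r j" for j using x by simp
  have "closed ?A" by (intro closed_Collect_le continuous_intros)
  then have [measurable]: "?A \<in> sets lebesgue" by auto
  have f: "(\<integral>\<^sup>+ t. ennreal \<bar>f t\<bar> * indicator (ball 0 (?r j)) t \<partial>lebesgue) \<le> ennreal (hc * 2 powr S * F * ?r j powr (n + n * \<beta>))" for j
    using F rj by (intro nn_integral_single_le) auto
  have bf: "(\<integral>\<^sup>+ t. ennreal (\<bar>b t - ball_avg b (?r j)\<bar> * \<bar>f t\<bar>) * indicator (ball 0 (?r j)) t \<partial>lebesgue)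
     \<le> ennreal (hc * G * F * ?r j powr (n + n * lam + n * \<beta>))" for j
    using F G rj by (intro nn_integral_product_le) auto
  have e1: "?r j powr (\<alpha> - n) * ?r j powr (n + n * \<beta>) = ?r j powr (n * lam)" for j
    by (simp add: beta_eq flip: powr_add)
  have "\<alpha> - n + (n + n * lam + n * \<beta>) = 2 * (n * lam)"
    using beta_eq by simp
  then have e2: "?r j powr (\<alpha> - n) * ?r j powr (n + n * lam + n * \<beta>) = ?r j powr (2 * (n * lam))" for j
    by (simp only: powr_add[symmetric])
  define k where "k = 2 powr (n - \<alpha>) * hc"
  have k: "0 \<le> k" using hc_pos by (simp add: k_def)
  have "\<bar>b x * (LINT t:?A|lebesgue. f t * ?w t) - (LINT t:?A|lebesgue. b t * (f t * ?w t))\<bar> \<le>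
      k * 2 powr S * F * E * r powr (n * lam) / (1 - 2 powr (n * lam)) +
      k * G * F * r powr (2 * (n * lam)) / (1 - 2 powr (2 * (n * lam)))"
  proof (rule commutator_integral_bound)
    have "(\<integral>\<^sup>+ t. ennreal \<bar>f t * ?w t\<bar> * indicator ?A t \<partial>lebesgue) = (\<integral>\<^sup>+ t. ennreal (\<bar>f t\<bar> * ?w t) * indicator ?A t \<partial>lebesgue)"
      by (simp add: abs_mult)
    also have "\<dots> \<le> (\<Sum>j. ennreal (?c j) * (\<integral>\<^sup>+ t. ennreal \<bar>f t\<bar> * indicator (ball 0 (?r j)) t \<partial>lebesgue))"
      using x by (intro nn_integral_tail_le) auto
    also have "\<dots> \<le> (\<Sum>j. ennreal (k * 2 powr S * F * ?r j powr (n * lam)))"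
    proof (intro suminf_le)
      fix j
      have "ennreal (?c j) * (\<integral>\<^sup>+ t. ennreal \<bar>f t\<bar> * indicator (ball 0 (?r j)) t \<partial>lebesgue) \<le>
          ennreal (?c j) * ennreal (hc * 2 powr S * F * ?r j powr (n + n * \<beta>))"
        by (intro mult_left_mono f) auto
      also have "\<dots> = ennreal (k * 2 powr S * F * (?r j powr (\<alpha> - n) * ?r j powr (n + n * \<beta>)))"
        by (subst ennreal_mult[symmetric]) (use F hc_pos in \<open>auto simp: k_def mult_ac\<close>)
      finally show "ennreal (?c j) * (\<integral>\<^sup>+ t. ennreal \<bar>f t\<bar> * indicator (ball 0 (?r j)) t \<partial>lebesgue) \<le>
          ennreal (k * 2 powr S * F * ?r j powr (n * lam))"
        unfolding e1 .
    qed auto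
    also have "\<dots> < top"
      using F k x nlam_neg by (subst geometric_suminf) auto
    finally show "(\<integral>\<^sup>+ t. ennreal \<bar>f t * ?w t\<bar> * indicator ?A t \<partial>lebesgue) < top" .

    let ?H = "\<lambda>j t. ennreal E * ennreal \<bar>f t\<bar> + ennreal (\<bar>b t - ball_avg b (?r j)\<bar> * \<bar>f t\<bar>)"
    have "(\<integral>\<^sup>+ t. ennreal (\<bar>b x - b t\<bar> * \<bar>f t * ?w t\<bar>) * indicator ?A t \<partial>lebesgue) =
        (\<integral>\<^sup>+ t. ennreal (\<bar>(b x - b t) * f t\<bar> * ?w t) * indicator ?A t \<partial>lebesgue)"
      by (simp add: abs_mult mult.assoc)
    also have "\<dots> \<le> (\<Sum>j. ennreal (?c j) * (\<integral>\<^sup>+ t. ?H j t * indicator (ball 0 (?r j)) t \<partial>lebesgue))"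
    proof (intro nn_integral_tail_le)
      fix j t
      have "\<bar>b x - b t\<bar> \<le> E + \<bar>b t - ball_avg b (?r j)\<bar>"
        using ball_avg_dyadic_diff[OF b assms(2) G x(1), of j] unfolding E_def D_def osc_const_def by linarith
      then have "\<bar>b x - b t\<bar> * \<bar>f t\<bar> \<le> (E + \<bar>b t - ball_avg b (?r j)\<bar>) * \<bar>f t\<bar>"
        by (intro mult_right_mono) auto
      then show "ennreal \<bar>(b x - b t) * f t\<bar> \<le> ?H j t"
        using E by (simp add: abs_mult distrib_right ennreal_leI flip: ennreal_mult ennreal_plus)
    qed (use x in auto)
    also have "\<dots> \<le> (\<Sum>j. ennreal (k * 2 powr S * F * E * ?r j powr (n * lam)) + ennreal (k * G * F * ?r j powr (2 * (n * lam))))"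
    proof (intro suminf_le)
      fix j
      have "(\<integral>\<^sup>+ t. ?H j t * indicator (ball 0 (?r j)) t \<partial>lebesgue) =
        (\<integral>\<^sup>+ t. ennreal E * (ennreal \<bar>f t\<bar> * indicator (ball 0 (?r j)) t) +
          ennreal (\<bar>b t - ball_avg b (?r j)\<bar> * \<bar>f t\<bar>) * indicator (ball 0 (?r j)) t \<partial>lebesgue)"
        by (simp add: distrib_right mult.assoc)
      also have "\<dots> = ennreal E * (\<integral>\<^sup>+ t. ennreal \<bar>f t\<bar> * indicator (ball 0 (?r j)) t \<partial>lebesgue) +
          (\<integral>\<^sup>+ t. ennreal (\<bar>b t - ball_avg b (?r j)\<bar> * \<bar>f t\<bar>) * indicator (ball 0 (?r j)) t \<partial>lebesgue)"
        by (subst nn_integral_add, measurable) (subst nn_integral_cmult, measurable)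
      also have "\<dots> \<le> ennreal E * ennreal (hc * 2 powr S * F * ?r j powr (n + n * \<beta>)) +
          ennreal (hc * G * F * ?r j powr (n + n * lam + n * \<beta>))"
        by (intro add_mono mult_left_mono f bf) auto
      finally have "ennreal (?c j) * (\<integral>\<^sup>+ t. ?H j t * indicator (ball 0 (?r j)) t \<partial>lebesgue) \<le>
          ennreal (?c j) * \<dots>"
        by (rule mult_left_mono) simp
      also have "\<dots> = ennreal (k * 2 powr S * F * E * (?r j powr (\<alpha> - n) * ?r j powr (n + n * \<beta>))) +
          ennreal (k * G * F * (?r j powr (\<alpha> - n) * ?r j powr (n + n * lam + n * \<beta>)))"
      proof -
        let ?X = "hc * 2 powr S * F * ?r j powr (n + n * \<beta>)" and ?Y = "hc * G * F * ?r j powr (n + n * lam + n * \<beta>)"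
        have "0 \<le> ?X" "0 \<le> ?Y" using F G hc_pos by simp_all
        then have "ennreal (?c j) * (ennreal E * ennreal ?X + ennreal ?Y) = ennreal (?c j * (E * ?X)) + ennreal (?c j * ?Y)"
          using E by (simp only: distrib_left ennreal_mult mult_nonneg_nonneg powr_ge_zero order.refl zero_le_numeral)
        moreover have "?c j * (E * ?X) = k * 2 powr S * F * E * (?r j powr (\<alpha> - n) * ?r j powr (n + n * \<beta>))"
          by (simp only: k_def mult_ac)
        moreover have "?c j * ?Y = k * G * F * (?r j powr (\<alpha> - n) * ?r j powr (n + n * lam + n * \<beta>))"
          by (simp only: k_def mult_ac)
        ultimately show ?thesis by (simp only:)
      qed
      finally show "ennreal (?c j) * (\<integral>\<^sup>+ t. ?H j t * indicator (ball 0 (?r j)) t \<partial>lebesgue) \<le>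
          ennreal (k * 2 powr S * F * E * ?r j powr (n * lam)) + ennreal (k * G * F * ?r j powr (2 * (n * lam)))"
        unfolding e1 e2 .
    qed auto
    also have "\<dots> = ennreal (k * 2 powr S * F * E * r powr (n * lam) / (1 - 2 powr (n * lam))) +
      ennreal (k * G * F * r powr (2 * (n * lam)) / (1 - 2 powr (2 * (n * lam))))"
    proof -
      have "0 \<le> k * 2 powr S * F * E" "0 \<le> k * G * F"
        using E F(1) G(1) k by simp_all
      moreover have "2 * (n * lam) < 0"
        using nlam_neg by linarith
      ultimately show ?thesis
        using nlam_neg x(1) by (subst suminf_add[symmetric]) (simp_all only: summableI geometric_suminf)
    qed
    finally show "(\<integral>\<^sup>+ t. ennreal (\<bar>b x - b t\<bar> * \<bar>f t * ?w t\<bar>) * indicator ?A t \<partial>lebesgue) \<le>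
        ennreal (k * 2 powr S * F * E * r powr (n * lam) / (1 - 2 powr (n * lam)) +
          k * G * F * r powr (2 * (n * lam)) / (1 - 2 powr (2 * (n * lam))))"
      using E F G k nlam_ratio by (subst ennreal_plus) auto
  next
    show "(\<lambda>t. f t * ?w t) \<in> borel_measurable lebesgue"
      by (intro borel_measurable_times powr_real_measurable) measurable
  qed (use E F(1) G(1) k nlam_ratio in auto)
  also have "\<dots> \<le> adj_const * F * (D * r powr (n * lam) + G * r powr (2 * (n * lam)))"
  proof -
    \<comment> \<open>With these abbreviations the final absorption is polynomial: expanding the
      product on the right gives every term on the left plus nonnegative ones.\<close>
    define u v where "u = 1 / (1 - 2 powr (n * lam))" and "v = 1 / (1 - 2 powr (2 * (n * lam)))"
    define X Y where "X = D * r powr (n * lam)" and "Y = G * r powr (2 * (n * lam))"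
    have nn: "0 \<le> u" "0 \<le> v" "0 \<le> X" "0 \<le> Y" using nlam_ratio D G by (auto simp: u_def v_def X_def Y_def)
    have XY: "E * r powr (n * lam) = X + osc_const * Y"
      unfolding E_def X_def Y_def mult_2 powr_add by (simp add: distrib_right mult.assoc)
    have "k * 2 powr S * F * E * r powr (n * lam) / (1 - 2 powr (n * lam)) +
      k * G * F * r powr (2 * (n * lam)) / (1 - 2 powr (2 * (n * lam))) =
        k * F * (2 powr S * (E * r powr (n * lam)) * u + Y * v)"
      by (simp add: u_def v_def Y_def distrib_left mult_ac)
    also note XY
    also have "k * F * (2 powr S * (X + osc_const * Y) * u + Y * v) \<le> k * F * ((1 + 2 powr S) * ((1 + osc_const) * u + v) * (X + Y))"
    proof (intro mult_left_mono)
      have "0 \<le> 2 powr S * osc_const * u * X" "0 \<le> 2 powr S * u * Y" "0 \<le> 2 powr S * v * Y"  "0 \<le> 2 powr S * v * X"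
         "0 \<le> osc_const * u * X" "0 \<le> osc_const * u * Y" "0 \<le> u * X" "0 \<le> u * Y" "0 \<le> v * X"
        using nn osc_const_nonneg by auto
      then show "2 powr S * (X + osc_const * Y) * u + Y * v \<le> (1 + 2 powr S) * ((1 + osc_const) * u + v) * (X + Y)"
        by (simp add: algebra_simps)
    qed (use k F in auto)
    finally show ?thesis by (simp add: adj_const_def k_def u_def v_def X_def Y_def mult_ac)
  qed
  finally have *: "\<bar>b x * (LINT t:?A|lebesgue. f t * ?w t) - (LINT t:?A|lebesgue. b t * (f t * ?w t))\<bar> \<le> \<dots>" .
  \<comment> \<open>Off the origin the adjoint operator is given by its integral rather than by the
    value 0 assigned there.\<close>
  have "x \<noteq> 0" using x by auto
  then show ?thesis
    using * by (simp add: hardy_adj_comm_def hardy_adj_def D_def n_eq mult.assoc)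
qed

end

section \<open>The equivalence\<close>

text \<open>Truncations to balls of integer radius are integrable, hence measurable, and are
  eventually constant at each point.\<close>

lemma locally_integrable_measurable:
  fixes b :: "(real, 'n::finite) vec \<Rightarrow> real"
  assumes "locally_integrable b"
  shows "b \<in> borel_measurable lebesgue"
proof (rule borel_measurable_LIMSEQ_real)
  fix x :: "(real, 'n) vec"
  obtain N :: nat where N: "norm x < real N" using reals_Archimedean2 by blast
  have "eventually (\<lambda>k. indicator (ball 0 (real k)) x *\<^sub>R b x = b x) sequentially"
    using eventually_ge_at_top[of N] by eventually_elim (use N in auto)
  then show "(\<lambda>k. indicator (ball 0 (real k)) x *\<^sub>R b x) \<longlonglongrightarrow> b x"
    by (rule tendsto_eventually)
next
  show "(\<lambda>x. indicator (ball 0 (real k)) x *\<^sub>R b x) \<in> borel_measurable lebesgue" for k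
    using locally_integrable_ball[OF assms, of "real k"]
    by (auto simp: set_integrable_def)
qed

text \<open>With a Borel representative of b the integrand is jointly measurable in x and t, so its
  integral over t is measurable in x.\<close>

lemma borel_measurable_ball_integral:
  fixes b :: "(real, 'n::finite) vec \<Rightarrow> real"
  assumes [measurable]: "b \<in> borel_measurable lebesgue"
  shows "(\<lambda>x :: (real, 'n) vec. LINT t:ball 0 (norm x)|lebesgue. b t) \<in> borel_measurable lebesgue"
proof -
  obtain b' where b' [measurable]: "b' \<in> borel_measurable lborel" "AE x in lborel. b x = b' x"
    using completion_ex_borel_measurable_real[OF assms] by auto
  have "(LINT t:ball 0 (norm x)|lebesgue. b t) = (LINT t|lborel. (if norm t < norm x then b' t else 0))" for x :: "(real, 'n) vec"
  proof -
    have m: "(\<lambda>t. if norm t < norm x then b' t else 0) \<in> borel_measurable lborel" by measurable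
    have "(LINT t:ball 0 (norm x)|lebesgue. b t) = (LINT t|lebesgue. (if norm t < norm x then b' t else 0))"
      unfolding set_lebesgue_integral_def
    proof (rule integral_cong_AE)
      show "AE t in lebesgue. indicator (ball 0 (norm x)) t *\<^sub>R b t = (if norm t < norm x then b' t else 0)"
        by (rule AE_completion) (use b'(2) in eventually_elim, auto)
    qed (use measurable_completion[OF m] in auto)
    also have "\<dots> = (LINT t|lborel. (if norm t < norm x then b' t else 0))"
      by (rule integral_completion[OF m])
    finally show ?thesis .
  qed
  moreover have "(\<lambda>x :: (real, 'n) vec. LINT t|lborel. (if norm t < norm x then b' t else 0)) \<in> borel_measurable lborel"
    by measurable
  ultimately show ?thesis
    by (simp add: measurable_completion)
qed

section \<open>From the Campanato condition to boundedness\<close>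

context hardy_exponents
begin

text \<open>The common last step for both commutators. The Morrey norm of f yields the size F,
  \<open>annular_bound\<close> turns the pointwise bound into growth of T f on balls, and
  \<open>ball_ratio_upper\<close> returns to a Morrey norm.\<close>

lemma morrey_boundedI:
  fixes b :: "(real, 'n) vec \<Rightarrow> real" and avg :: "real \<Rightarrow> real"
  assumes b: "b \<in> borel_measurable lebesgue"
    and G: "0 \<le> G" "\<And>r. 0 < r \<Longrightarrow> bnorm (\<lambda>x. b x - avg r) r \<le> ennreal (G * r powr (n * lam + S))"
    and C: "0 \<le> C"
    and T: "\<And>f F x r. f \<in> borel_measurable lebesgue \<Longrightarrow> 0 \<le> F \<Longrightarrow>
        (\<And>r. 0 < r \<Longrightarrow> bnorm f r \<le> ennreal (F * r powr (n * \<beta> + S))) \<Longrightarrow>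
        0 < r \<Longrightarrow> r / 2 \<le> norm x \<Longrightarrow> norm x < r \<Longrightarrow>
        \<bar>T f x\<bar> \<le> C * F * (\<bar>b x - avg r\<bar> * r powr (n * lam) + G * r powr (2 * (n * lam)))"
  shows "morrey_bounded p \<beta> (2 * lam) T"
proof -
  obtain d where d: "0 < d" "\<And>N r. 0 < r \<Longrightarrow> N r \<le> ennreal (d * r powr (n * \<beta> + S)) * ball_ratio \<beta> N"
    using ball_ratio_lower[of \<beta>] by blast
  obtain c where c: "0 < c" "\<And>N K. (\<And>r. 0 < r \<Longrightarrow> N r \<le> K * ennreal (r powr (n * (2 * lam) + S))) \<Longrightarrow> ball_ratio (2 * lam) N \<le> ennreal c * K"
    using ball_ratio_upper[of "2 * lam"] by blast
  \<comment> \<open>This is the constant of \<open>annular_bound\<close> with its factor K removed,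
    so that the dependence on f stays linear.\<close>
  define Q where "Q = G * (1 + 2 powr S) / (1 - 2 powr - (2 * (n * lam) + S))"
  have "2 powr - (2 * (n * lam) + S) < (1::real)"
    using lam_S powr_less_one[of 2 "- (2 * (n * lam) + S)"] by linarith
  then have Q: "0 \<le> Q" using G(1) by (simp add: Q_def)
  show ?thesis
    unfolding morrey_bounded_def
  proof (intro exI[of _ "c * (C * d * Q)"] conjI ballI)
    show "0 \<le> c * (C * d * Q)" using c d C Q by simp
    fix f assume f: "f \<in> morrey_space p \<beta>"
    then have fm: "f \<in> borel_measurable lebesgue" and "morrey_norm p \<beta> f < top"
      by (auto simp: morrey_space_def)
    then obtain m where m: "morrey_norm p \<beta> f = ennreal m" "0 \<le> m"
      by (cases "morrey_norm p \<beta> f") auto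
    have F: "bnorm f r \<le> ennreal (d * m * r powr (n * \<beta> + S))" if "0 < r" for r
    proof -
      have "bnorm f r \<le> ennreal (d * r powr (n * \<beta> + S)) * ennreal m"
        using d(2)[OF that, of "bnorm f"] m by (simp add: morrey_norm_eq)
      also have "\<dots> = ennreal (d * m * r powr (n * \<beta> + S))"
        using m by (subst ennreal_mult''[symmetric]) (auto simp: mult_ac)
      finally show ?thesis .
    qed
    have "morrey_norm p (2 * lam) (T f) \<le> ennreal c * ennreal (C * (d * m) * Q)"
      unfolding morrey_norm_eq
    proof (rule c(2))
      fix r :: real assume r: "0 < r"
      have "bnorm (T f) r \<le> ennreal (C * (d * m) * G * (1 + 2 powr S) / (1 - 2 powr - (2 * (n * lam) + S)) * r powr (2 * (n * lam) + S))"
        using d m C r by (intro annular_bound[OF b G, of "C * (d * m)"] T fm F) auto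
      also have "C * (d * m) * G * (1 + 2 powr S) / (1 - 2 powr - (2 * (n * lam) + S)) = C * (d * m) * Q"
        by (simp add: Q_def)
      also have "2 * (n * lam) + S = n * (2 * lam) + S" by simp
      also have "ennreal (C * (d * m) * Q * r powr (n * (2 * lam) + S)) = ennreal (C * (d * m) * Q) * ennreal (r powr (n * (2 * lam) + S))"
        using C d(1) m(2) Q by (intro ennreal_mult) auto
      finally show "bnorm (T f) r \<le> ennreal (C * (d * m) * Q) * ennreal (r powr (n * (2 * lam) + S))" .
    qed
    also have "\<dots> = ennreal (c * (C * d * Q)) * morrey_norm p \<beta> f"
      unfolding m using c C d m Q by (simp add: mult_ac flip: ennreal_mult)
    finally show "morrey_norm p (2 * lam) (T f) \<le> ennreal (c * (C * d * Q)) * morrey_norm p \<beta> f" .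
  qed
qed

lemma campanato_imp_bounded:
  fixes b :: "(real, 'n) vec \<Rightarrow> real"
  assumes loc: "locally_integrable b" and b: "b \<in> campanato_space p lam"
  shows "morrey_bounded p \<beta> (2 * lam) (hardy_comm \<alpha> b)"
    and "morrey_bounded p \<beta> (2 * lam) (hardy_adj_comm \<alpha> b)"
proof -
  obtain d where d: "0 < d" "\<And>N r. 0 < r \<Longrightarrow> N r \<le> ennreal (d * r powr (n * lam + S)) * ball_ratio lam N"
    using ball_ratio_lower[of lam] by blast
  from b have bm: "b \<in> borel_measurable lebesgue" and "campanato_norm p lam b < top"
    by (auto simp: campanato_space_def)
  then obtain m where m: "campanato_norm p lam b = ennreal m" "0 \<le> m"
    by (cases "campanato_norm p lam b") auto
  have G: "bnorm (\<lambda>x. b x - ball_avg b r) r \<le> ennreal (d * m * r powr (n * lam + S))" if "0 < r" for r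
  proof -
    have "bnorm (\<lambda>x. b x - ball_avg b r) r \<le> ennreal (d * r powr (n * lam + S)) * ennreal m"
      using d(2)[OF that, of "\<lambda>r. bnorm (\<lambda>x. b x - ball_avg b r) r"] m by (simp add: campanato_norm_eq)
    also have "\<dots> = ennreal (d * m * r powr (n * lam + S))"
      using m by (subst ennreal_mult''[symmetric]) (auto simp: mult_ac)
    finally show ?thesis .
  qed
  have dm: "0 \<le> d * m" using d m by simp
  show "morrey_bounded p \<beta> (2 * lam) (hardy_comm \<alpha> b)"
    by (rule morrey_boundedI[OF bm dm G _ hardy_comm_pointwise[OF bm _ dm G]]) (use hc_pos in auto)
  show "morrey_bounded p \<beta> (2 * lam) (hardy_adj_comm \<alpha> b)"
    by (rule morrey_boundedI[OF bm dm G adj_const_nonneg hardy_adj_comm_pointwise[OF loc bm _ dm G]])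
qed

section \<open>From boundedness to the Campanato condition\<close>

text \<open>A ball of radius s meets the support in the ball of radius t = min r s. Both -n beta and
  n beta + S are positive, so t^S splits into a power bounded by that of r and a power bounded by
  that of s.\<close>

lemma test_function_bound:
  "\<exists>c>0. \<forall>(f :: (real, 'n) vec \<Rightarrow> real) r A. 0 < r \<longrightarrow> 0 \<le> A \<longrightarrow> (\<forall>x. \<bar>f x\<bar> \<le> A * indicator (ball 0 r) x)
     \<longrightarrow> morrey_norm p \<beta> f \<le> ennreal (c * (A * r powr - (n * \<beta>)))"
proof -
  obtain c where c: "0 < c" "\<And>N K. (\<And>r. 0 < r \<Longrightarrow> N r \<le> K * ennreal (r powr (n * \<beta> + S))) \<Longrightarrow> ball_ratio \<beta> N \<le> ennreal c * K"
    using ball_ratio_upper[of \<beta>] by blast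
  show ?thesis
  proof (intro exI[of _ "c * 2 powr S"] conjI allI impI)
    show "0 < c * 2 powr S" using c by simp
    fix f :: "(real, 'n) vec \<Rightarrow> real" and r A :: real
    assume r: "0 < r" and A: "0 \<le> A" and f: "\<forall>x. \<bar>f x\<bar> \<le> A * indicator (ball 0 r) x"
    have "morrey_norm p \<beta> f \<le> ennreal c * ennreal (2 powr S * (A * r powr - (n * \<beta>)))"
      unfolding morrey_norm_eq
    proof (rule c(2))
      fix s :: real assume s: "0 < s"
      define t where "t = min r s"
      have t: "0 < t" "t \<le> r" "t \<le> s" using r s by (auto simp: t_def)
      have "bnorm f s \<le> bnorm (\<lambda>_. A * 1) t"
        unfolding bnorm_def
      proof (rule mnorm_mono)
        fix x
        show "ennreal \<bar>f x\<bar> * indicator (ball 0 s) x \<le> ennreal \<bar>A * 1\<bar> * indicator (ball 0 t) x"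
          using f[rule_format, of x] A by (auto simp: t_def indicator_def intro!: ennreal_leI split: if_splits)
      qed
      also have "\<dots> = ennreal A * bnorm (\<lambda>_. 1) t"
        using A by (subst bnorm_cmult) auto
      also have "\<dots> \<le> ennreal A * ennreal (2 powr S * t powr S)"
        by (intro mult_left_mono bnorm_const_1 t) auto
      also have "\<dots> = ennreal (2 powr S * A * t powr S)"
        using A by (subst ennreal_mult[symmetric]) (auto simp: mult_ac)
      also have "\<dots> \<le> ennreal (2 powr S * A * (r powr - (n * \<beta>) * s powr (n * \<beta> + S)))"
      proof (intro ennreal_leI mult_left_mono)
        have "t powr S = t powr - (n * \<beta>) * t powr (n * \<beta> + S)" by (simp flip: powr_add)
        also have "\<dots> \<le> r powr - (n * \<beta>) * s powr (n * \<beta> + S)"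
          using t beta_S beta_eq nlam_neg alpha_pos by (intro mult_mono powr_mono2) auto
        finally show "t powr S \<le> r powr - (n * \<beta>) * s powr (n * \<beta> + S)" .
      qed (use A in auto)
      also have "\<dots> = ennreal (2 powr S * (A * r powr - (n * \<beta>))) * ennreal (s powr (n * \<beta> + S))"
        using A by (subst ennreal_mult[symmetric]) (auto simp: mult_ac)
      finally show "bnorm f s \<le> ennreal (2 powr S * (A * r powr - (n * \<beta>))) * ennreal (s powr (n * \<beta> + S))" .
    qed
    also have "\<dots> = ennreal (c * 2 powr S * (A * r powr - (n * \<beta>)))"
      using c A by (subst ennreal_mult[symmetric]) (auto simp: mult_ac)
    finally show "morrey_norm p \<beta> f \<le> ennreal (c * 2 powr S * (A * r powr - (n * \<beta>)))" .
  qed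
qed

text \<open>For |x| \<le> r the ball of radius |x| lies where the test function is 1, which leaves
  only its volume and the integral of b over it.\<close>

lemma hardy_comm_indicator:
  fixes b :: "(real, 'n) vec \<Rightarrow> real"
  assumes x: "norm x \<le> r"
  shows "hardy_comm \<alpha> b (indicator (ball 0 r)) x = norm x powr (\<alpha> - n) *
     (b x * measure lebesgue (ball (0 :: (real, 'n) vec) (norm x)) - (LINT t:ball 0 (norm x)|lebesgue. b t))"
proof -
  have 1: "(LINT t:ball (0 :: (real, 'n) vec) (norm x)|lebesgue. indicator (ball 0 r) t) = measure lebesgue (ball (0 :: (real, 'n) vec) (norm x))"
  proof -
    have "(LINT t:ball (0 :: (real, 'n) vec) (norm x)|lebesgue. indicator (ball 0 r) t) = (LINT t|lebesgue. indicator (ball (0 :: (real, 'n) vec) (norm x)) t :: real)"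
      unfolding set_lebesgue_integral_def using x
      by (intro Bochner_Integration.integral_cong) (auto simp: indicator_def)
    then show ?thesis by simp
  qed
  have 2: "(LINT t:ball 0 (norm x)|lebesgue. b t * indicator (ball 0 r) t) = (LINT t:ball 0 (norm x)|lebesgue. b t)"
    unfolding set_lebesgue_integral_def using x
    by (intro Bochner_Integration.integral_cong) (auto simp: indicator_def)
  show ?thesis
    unfolding hardy_comm_def hardy_def 1 2 by (simp only: n_eq algebra_simps)
qed

text \<open>The power in the test function cancels the kernel, so the integrals run over the shell
  between radius |x| and r with weight 1.\<close>

lemma hardy_adj_comm_power:
  fixes b :: "(real, 'n) vec \<Rightarrow> real"
  assumes b: "locally_integrable b" and x: "x \<noteq> 0" "norm x \<le> r"
  shows "hardy_adj_comm \<alpha> b (\<lambda>y. norm y powr (n - \<alpha>) * indicator (ball 0 r) y) x =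
     b x * (measure lebesgue (ball (0 :: (real, 'n) vec) r) - measure lebesgue (ball (0 :: (real, 'n) vec) (norm x)))
       - ((LINT t:ball 0 r|lebesgue. b t) - (LINT t:ball 0 (norm x)|lebesgue. b t))"
proof -
  let ?A = "{t :: (real, 'n) vec. norm x \<le> norm t}"
  have "(LINT t:?A|lebesgue. g t * (norm t powr (n - \<alpha>) * indicator (ball 0 r) t) * norm t powr (\<alpha> - n)) =
      (LINT t:ball 0 r|lebesgue. g t) - (LINT t:ball 0 (norm x)|lebesgue. g t)"
    if g: "\<And>r. set_integrable lebesgue (ball 0 r) g" for g :: "(real, 'n) vec \<Rightarrow> real"
  proof -
    have "(LINT t:?A|lebesgue. g t * (norm t powr (n - \<alpha>) * indicator (ball 0 r) t) * norm t powr (\<alpha> - n)) =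
       (LINT t|lebesgue. indicator (ball 0 r) t *\<^sub>R g t - indicator (ball 0 (norm x)) t *\<^sub>R g t)"
      unfolding set_lebesgue_integral_def
    proof (intro Bochner_Integration.integral_cong refl)
      fix t :: "(real, 'n) vec"
      \<comment> \<open>Here x must be nonzero: at t = 0 the product would be 0, because
        \<open>powr\<close> with base 0 is 0.\<close>
      have "norm t powr (n - \<alpha>) * norm t powr (\<alpha> - n) = 1" if "norm x \<le> norm t"
        using that x by (auto simp flip: powr_add)
      then show "indicator ?A t *\<^sub>R (g t * (norm t powr (n - \<alpha>) * indicator (ball 0 r) t) * norm t powr (\<alpha> - n)) =
         indicator (ball 0 r) t *\<^sub>R g t - indicator (ball 0 (norm x)) t *\<^sub>R g t"
        using x by (auto simp: indicator_def)
    qed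
    also have "\<dots> = (LINT t:ball 0 r|lebesgue. g t) - (LINT t:ball 0 (norm x)|lebesgue. g t)"
      unfolding set_lebesgue_integral_def
      using g by (intro Bochner_Integration.integral_diff) (auto simp: set_integrable_def)
    finally show ?thesis .
  qed
  note key = this
  have one: "set_integrable lebesgue (ball 0 r) (\<lambda>_ :: (real, 'n) vec. 1 :: real)" for r
    using emeasure_bounded_finite[of "ball (0 :: (real, 'n) vec) r"]
    by (auto simp: set_integrable_def)
  show ?thesis
    using key[of b] key[OF one] x locally_integrable_ball[OF b]
    by (simp add: hardy_adj_comm_def hardy_adj_def set_lebesgue_integral_def n_eq)
qed

text \<open>The Hardy commutator sees b x against the ball of radius |x|, the adjoint one against
  the rest of the ball of radius r; together they recover the oscillation times the full volume.
  Their weights cost the same factor r^(n - alpha).\<close>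

lemma bounded_imp_campanato:
  fixes b :: "(real, 'n) vec \<Rightarrow> real"
  assumes loc: "locally_integrable b"
    and bd1: "morrey_bounded p \<beta> (2 * lam) (hardy_comm \<alpha> b)"
    and bd2: "morrey_bounded p \<beta> (2 * lam) (hardy_adj_comm \<alpha> b)"
  shows "b \<in> campanato_space p lam"
proof -
  have bm [measurable]: "b \<in> borel_measurable lebesgue"
    by (rule locally_integrable_measurable[OF loc])
  obtain d where d: "0 < d" "\<And>N r. 0 < r \<Longrightarrow> N r \<le> ennreal (d * r powr (n * (2 * lam) + S)) * ball_ratio (2 * lam) N"
    using ball_ratio_lower[of "2 * lam"] by blast
  obtain c where c: "0 < c" "\<And>(f :: (real, 'n) vec \<Rightarrow> real) r A. 0 < r \<Longrightarrow> 0 \<le> A \<Longrightarrow> (\<And>x. \<bar>f x\<bar> \<le> A * indicator (ball 0 r) x)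
     \<Longrightarrow> morrey_norm p \<beta> f \<le> ennreal (c * (A * r powr - (n * \<beta>)))"
    using test_function_bound by metis
  \<comment> \<open>Boundedness is read off for test functions of size A supported in a ball and
    evaluated on that same ball, with one constant for all radii.\<close>
  have test: "\<exists>C\<ge>0. \<forall>f r A. f \<in> borel_measurable lebesgue \<longrightarrow> 0 < r \<longrightarrow> 0 \<le> A \<longrightarrow> (\<forall>x. \<bar>f x\<bar> \<le> A * indicator (ball 0 r) x)
     \<longrightarrow> bnorm (T f) r \<le> ennreal (C * A * r powr (n * (2 * lam) + S - n * \<beta>))"
    if "morrey_bounded p \<beta> (2 * lam) T" for T
  proof -
    from that obtain C where C: "0 \<le> C" "\<And>f. f \<in> morrey_space p \<beta> \<Longrightarrow> morrey_norm p (2 * lam) (T f) \<le> ennreal C * morrey_norm p \<beta> f"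
      unfolding morrey_bounded_def by blast
    show ?thesis
    proof (intro exI[of _ "d * C * c"] conjI allI impI)
      show "0 \<le> d * C * c" using d C c by simp
      fix f :: "(real, 'n) vec \<Rightarrow> real" and r A :: real
      assume f: "f \<in> borel_measurable lebesgue" "\<forall>x. \<bar>f x\<bar> \<le> A * indicator (ball 0 r) x" and r: "0 < r" and A: "0 \<le> A"
      have le: "morrey_norm p \<beta> f \<le> ennreal (c * (A * r powr - (n * \<beta>)))"
        using c(2)[OF r A] f by blast
      then have "f \<in> morrey_space p \<beta>" using f by (auto simp: morrey_space_def le_less_trans)
      then have "morrey_norm p (2 * lam) (T f) \<le> ennreal C * ennreal (c * (A * r powr - (n * \<beta>)))"
        using C(2)[of f] le by (meson mult_left_mono order_trans zero_le)
      then have "bnorm (T f) r \<le> ennreal (d * r powr (n * (2 * lam) + S)) * (ennreal C * ennreal (c * (A * r powr - (n * \<beta>))))"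
        using d(2)[OF r, of "bnorm (T f)"] unfolding morrey_norm_eq by (meson mult_left_mono order_trans zero_le)
      also have "\<dots> = ennreal (d * C * c * A * (r powr (n * (2 * lam) + S) * r powr - (n * \<beta>)))"
        using d(1) C(1) c(1) A by (simp add: mult_ac flip: ennreal_mult)
      also have "r powr (n * (2 * lam) + S) * r powr - (n * \<beta>) = r powr (n * (2 * lam) + S - n * \<beta>)"
        by (simp flip: powr_add)
      finally show "bnorm (T f) r \<le> ennreal (d * C * c * A * r powr (n * (2 * lam) + S - n * \<beta>))" .
    qed
  qed
  obtain C1 where C1: "0 \<le> C1" "\<And>f r A. f \<in> borel_measurable lebesgue \<Longrightarrow> 0 < r \<Longrightarrow> 0 \<le> A \<Longrightarrow> (\<And>x. \<bar>f x\<bar> \<le> A * indicator (ball 0 r) x)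
     \<Longrightarrow> bnorm (hardy_comm \<alpha> b f) r \<le> ennreal (C1 * A * r powr (n * (2 * lam) + S - n * \<beta>))"
    using test[OF bd1] by metis
  obtain C2 where C2: "0 \<le> C2" "\<And>f r A. f \<in> borel_measurable lebesgue \<Longrightarrow> 0 < r \<Longrightarrow> 0 \<le> A \<Longrightarrow> (\<And>x. \<bar>f x\<bar> \<le> A * indicator (ball 0 r) x)
     \<Longrightarrow> bnorm (hardy_adj_comm \<alpha> b f) r \<le> ennreal (C2 * A * r powr (n * (2 * lam) + S - n * \<beta>))"
    using test[OF bd2] by metis
  have est: "bnorm (\<lambda>x. b x - ball_avg b r) r \<le> ennreal ((C1 + C2) / vol) * ennreal (r powr (n * lam + S))" if r: "0 < r" for r
  proof -
    let ?\<mu> = "\<lambda>s. measure lebesgue (ball (0 :: (real, 'n) vec) s)"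
    let ?\<psi> = "\<lambda>s. LINT t:ball 0 s|lebesgue. b t"
    define m where "m = vol * r powr n"
    have m: "?\<mu> r = m" using r unfolding m_def by (subst measure_ball_powr) (simp_all add: n_eq)
    have m_pos: "0 < m" using vol_pos r by (simp add: m_def)
    let ?f = "\<lambda>y :: (real, 'n) vec. norm y powr (n - \<alpha>) * indicator (ball 0 r) y"
    define U where "U x = b x * ?\<mu> (norm x) - ?\<psi> (norm x)" for x
    \<comment> \<open>Defined as the remainder, so that U + V is the scaled oscillation by
      construction; off the origin V is the adjoint commutator of the power.\<close>
    define V where "V x = m * (b x - ball_avg b r) - U x" for x
    define E where "E = r powr (n * (2 * lam) + S - n * \<beta>)"
    have "?\<mu> (norm x) = vol * norm x ^ CARD('n)" for x :: "(real, 'n) vec"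
      by (simp add: content_ball n_eq)
    then have Um [measurable]: "U \<in> borel_measurable lebesgue"
      unfolding U_def using borel_measurable_ball_integral[OF bm]
      by (simp only:) (intro borel_measurable_diff borel_measurable_times borel_measurable_power, measurable)
    have Vm [measurable]: "V \<in> borel_measurable lebesgue"
      unfolding V_def by measurable
    have ne: "AE x in lborel. x \<noteq> (0 :: (real, 'n) vec)"
      by (rule AE_lborel_singleton)
    have "bnorm U r \<le> bnorm (\<lambda>x. r powr (n - \<alpha>) * (norm x powr (\<alpha> - n) * U x)) r"
    proof (rule bnorm_mono_AE, use ne in eventually_elim, intro impI)
      fix x :: "(real, 'n) vec" assume x: "x \<noteq> 0" "norm x < r"
      \<comment> \<open>The weight |x|^(alpha - n) of the Hardy commutator is undone at the cost of
        r^(n - alpha), since |x| < r and alpha < n.\<close>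
      have "1 = norm x powr (n - \<alpha>) * norm x powr (\<alpha> - n)" using x by (simp flip: powr_add)
      also have "\<dots> \<le> r powr (n - \<alpha>) * norm x powr (\<alpha> - n)"
        using x alpha_less by (intro mult_right_mono powr_mono2) auto
      finally have "1 * \<bar>U x\<bar> \<le> r powr (n - \<alpha>) * norm x powr (\<alpha> - n) * \<bar>U x\<bar>"
        by (intro mult_right_mono) auto
      then show "\<bar>U x\<bar> \<le> \<bar>r powr (n - \<alpha>) * (norm x powr (\<alpha> - n) * U x)\<bar>"
        by (simp add: abs_mult)
    qed
    also have "\<dots> = ennreal (r powr (n - \<alpha>)) * bnorm (\<lambda>x. norm x powr (\<alpha> - n) * U x) r"
      by (subst bnorm_cmult) auto
    also have "\<dots> \<le> ennreal (r powr (n - \<alpha>)) * bnorm (hardy_comm \<alpha> b (indicator (ball 0 r))) r"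
      by (intro mult_left_mono bnorm_mono_AE) (auto simp: hardy_comm_indicator U_def)
    also have "\<dots> \<le> ennreal (r powr (n - \<alpha>)) * ennreal (C1 * 1 * E)"
      unfolding E_def using r by (intro mult_left_mono C1(2)) (auto simp: indicator_def)
    finally have U: "bnorm U r \<le> ennreal (C1 * (r powr (n - \<alpha>) * E))"
      using C1(1) by (simp add: E_def mult_ac flip: ennreal_mult)
    have "bnorm V r \<le> bnorm (hardy_adj_comm \<alpha> b ?f) r"
    proof (rule bnorm_mono_AE, use ne in eventually_elim, intro impI)
      fix x :: "(real, 'n) vec" assume x: "x \<noteq> 0" "norm x < r"
      have "m * ball_avg b r = ?\<psi> r"
        using m_pos by (simp only: ball_avg_def m) simp
      then have "V x = hardy_adj_comm \<alpha> b ?f x"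
        using x hardy_adj_comm_power[OF loc, of x r] unfolding V_def U_def m by (simp add: algebra_simps)
      then show "\<bar>V x\<bar> \<le> \<bar>hardy_adj_comm \<alpha> b ?f x\<bar>" by simp
    qed
    \<comment> \<open>The power test function is bounded on the ball by A = r^(n - alpha).\<close>
    also have "\<dots> \<le> ennreal (C2 * r powr (n - \<alpha>) * E)"
      unfolding E_def using r alpha_less
      by (intro C2(2)) (auto simp: indicator_def intro!: powr_mono2)
    finally have V: "bnorm V r \<le> ennreal (C2 * (r powr (n - \<alpha>) * E))"
      by (simp add: mult.assoc)
    have "bnorm (\<lambda>x. b x - ball_avg b r) r = bnorm (\<lambda>x. 1 / m * (U x + V x)) r"
      using m_pos by (simp add: V_def)
    also have "\<dots> = ennreal (1 / m) * bnorm (\<lambda>x. U x + V x) r"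
      using m_pos by (subst bnorm_cmult) auto
    also have "\<dots> \<le> ennreal (1 / m) * (ennreal (C1 * (r powr (n - \<alpha>) * E)) + ennreal (C2 * (r powr (n - \<alpha>) * E)))"
      by (intro mult_left_mono order_trans[OF bnorm_add] add_mono U V) auto
    also have "\<dots> = ennreal (1 / m * ((C1 + C2) * (r powr (n - \<alpha>) * E)))"
      using m_pos C1(1) C2(1) by (simp add: E_def distrib_right flip: ennreal_mult ennreal_plus)
    also have "1 / m * ((C1 + C2) * (r powr (n - \<alpha>) * E)) = (C1 + C2) / vol * r powr (n * lam + S)"
    proof -
      \<comment> \<open>Inserting n beta = n lam - alpha cancels alpha; what remains is the volume
        exponent n and the Campanato exponent n lam + S.\<close>
      have "n - \<alpha> + (n * (2 * lam) + S - n * \<beta>) = n + (n * lam + S)"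
        using beta_eq by (simp add: algebra_simps)
      then have "r powr (n - \<alpha>) * E = r powr n * r powr (n * lam + S)"
        unfolding E_def by (simp only: powr_add[symmetric])
      then show ?thesis using r by (simp add: m_def)
    qed
    finally show ?thesis
      using C1(1) C2(1) vol_pos by (subst ennreal_mult[symmetric]) auto
  qed
  obtain k where k: "0 < k" "\<And>N K. (\<And>r. 0 < r \<Longrightarrow> N r \<le> K * ennreal (r powr (n * lam + S))) \<Longrightarrow> ball_ratio lam N \<le> ennreal k * K"
    using ball_ratio_upper[of lam] by blast
  have "campanato_norm p lam b \<le> ennreal k * ennreal ((C1 + C2) / vol)"
    unfolding campanato_norm_eq by (rule k(2)) (rule est)
  also have "\<dots> < top" by (simp add: ennreal_mult_less_top)
  finally show ?thesis
    using bm by (simp add: campanato_space_def)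
qed

end

theorem theorem1p7:
  fixes p :: "'n::{finite,linorder} \<Rightarrow> real"
    and lam \<alpha> \<beta> :: real
    and b :: "(real, 'n) vec \<Rightarrow> real"
  assumes p_range: "\<forall>i. 2 < p i"
    and lam_lower: "- (1 / real CARD('n)) * (\<Sum>i\<in>UNIV. 1 / (2 * p i)) < lam"
    and lam_upper: "lam < 0"
    and alpha_pos: "0 < \<alpha>"
    and alpha_upper: "\<alpha> < min (real CARD('n) * (1 - (1 / real CARD('n)) * (\<Sum>i\<in>UNIV. 1 / p i)))
                              (real CARD('n) * (lam + (1 / real CARD('n)) * (\<Sum>i\<in>UNIV. 1 / p i)))"
    and beta_def: "\<beta> = lam - \<alpha> / real CARD('n)"
    and b_loc: "locally_integrable b"
  shows "b \<in> campanato_space p lam \<longleftrightarrow>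
         (morrey_bounded p \<beta> (2 * lam) (hardy_comm \<alpha> b) \<and>
          morrey_bounded p \<beta> (2 * lam) (hardy_adj_comm \<alpha> b))"
proof -
  define n where "n = real CARD('n)"
  have n: "0 < n" by (simp add: n_def)
  interpret mixed_exponents p n
    by standard (use p_range in \<open>auto simp: n_def\<close>)
  have "(\<Sum>i\<in>UNIV. 1 / (2 * p i)) = S / 2"
    by (simp add: S_def sum_divide_distrib mult.commute)
  then have lam_S: "0 < 2 * (n * lam) + S"
    using lam_lower n by (simp add: n_def[symmetric] field_simps)
  have beta: "n * \<beta> = n * lam - \<alpha>"
    using n by (simp add: beta_def n_def[symmetric] algebra_simps)
  \<comment> \<open>The first bound gives alpha < n because S > 0; the second says that n beta + S >
    0.\<close>
  have "\<alpha> < n - S" "\<alpha> < n * lam + S"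
    using alpha_upper n by (simp_all add: n_def[symmetric] S_def[symmetric] algebra_simps)
  then interpret hardy_exponents p n lam \<alpha> \<beta>
    using lam_upper lam_S alpha_pos beta S_pos by unfold_locales auto
  show ?thesis
    using campanato_imp_bounded[OF b_loc] bounded_imp_campanato[OF b_loc] by blast
qed

end
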